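(* Let $k\ge2$ and let $\lambda\in\mathbb{R}^k$ be positive. Then there exist infinitely many $2$-homogeneous functions $\mathbf{u}\in H^1_{\mathrm{loc}}(\mathbb{R}^2,\Sigma_k)$ satisfying the following three conditions: (i) $\mathbf{u}\in\mathcal{T}_{\lambda,\mathrm{loc}}(\mathbb{R}^2)$; (ii) $Z(\mathbf{u})=\{\mathbf{u}=0\}$ has empty interior; (iii) the reflection law holds at regular points of $Z(\mathbf{u})$: given $x_0\in\mathcal{R}(\mathbf{u})$ and denoting by $\nu$ the normal vector to $Z(\mathbf{u})$ at $x_0$, it holds $$\lim_{x\to x_0,\ x\in\{u_i>0\}}\nabla u_i(x)\cdot\nu=-\lim_{x\to x_0,\ x\in\{u_j>0\}}\nabla u_j(x)\cdot\nu,$$ where $i\ne j$ are the indices of the two components that are positive on the two sides of $Z(\mathbf{u})$ near $x_0$.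
   Context: Here $N=2$. A vector in $\mathbb{R}^k$ is positive if all its components are positive. $\Sigma_k:=\{\xi\in\mathbb{R}^k\mid\sum_{i\ne j}\xi_i^2\xi_j^2=0\}$, and $H^1_{\mathrm{loc}}(\mathbb{R}^2,\Sigma_k)$ is the set of $\mathbf{u}\in H^1_{\mathrm{loc}}(\mathbb{R}^2,\mathbb{R}^k)$ with values in $\Sigma_k$ a.e. $2$-homogeneous means $\mathbf{u}(tx)=t^2\mathbf{u}(x)$ for all $t>0$. For a domain $A\subset\mathbb{R}^N$ and a positive $\lambda\in\mathbb{R}^k$, $\mathbf{u}\in\mathcal{T}_\lambda(A)$ means: (1) $\mathbf{u}\not\equiv0$ is non-negative, locally Lipschitz continuous in $A$, and $u_iu_j\equiv0$ in $A$ for $i\ne j$; (2) $-\Delta u_i=\lambda_i$ in $\{u_i>0\}$ for each $i$; (3) for every $x_0\in A$ with $\mathbf{u}(x_0)=0$ and every $r\in(0,\mathrm{dist}(x_0,\partial A))$, $$r\int_{\partial B_r(x_0)}|\nabla\mathbf{u}|^2\,d\sigma=(N-2)\int_{B_r(x_0)}|\nabla\mathbf{u}|^2\,dx+2r\int_{\partial B_r(x_0)}|\partial_\nu\mathbf{u}|^2\,d\sigma+2r\int_{\partial B_r(x_0)}(\lambda\cdot\mathbf{u})\,d\sigma-2N\int_{B_r(x_0)}(\lambda\cdot\mathbf{u})\,dx.$$ $\mathbf{u}\in\mathcal{T}_{\lambda,\mathrm{loc}}(\mathbb{R}^2)$ means that this holds in the domains $A\Subset\mathbb{R}^2$ (up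 to the non-triviality requirement on small subdomains). The regular set is $\mathcal{R}(\mathbf{u}):=\{x_0\in Z(\mathbf{u})\mid\mathcal{O}(\mathbf{u},x_0)=1\}$, where $$\mathcal{O}(\mathbf{u},x_0):=\sup\Big\{\gamma>0\ \Big|\ \limsup_{r\to0^+}\frac{\|\mathbf{u}\|_{x_0,r}}{r^\gamma}<+\infty\Big\},\qquad \|\mathbf{u}\|_{x_0,r}^2:=\sum_{i=1}^k\Big(\frac1{r^{N-2}}\int_{B_r(x_0)}|\nabla u_i|^2\,dx+\frac1{r^{N-1}}\int_{\partial B_r(x_0)}u_i^2\,d\sigma\Big).$$ *)

theory Defs
  imports "HOL-Analysis.Analysis"
begin

section \<open>Differential calculus in the plane\<close>

text \<open>
  Total version of the gradient: it is set to 0 where \<open>f\<close> is not differentiable. For the locally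
  Lipschitz functions below this happens only on a null set, and the result is then a representative
  of the weak gradient.
\<close>

definition grad :: "('a::euclidean_space \<Rightarrow> real) \<Rightarrow> 'a \<Rightarrow> 'a" where
  "grad f x = (if f differentiable (at x) then (THE D. GDERIV f x :> D) else 0)"

primrec cont_diff_on :: "nat \<Rightarrow> 'a::euclidean_space set \<Rightarrow> ('a \<Rightarrow> real) \<Rightarrow> bool" where
  "cont_diff_on 0 S f \<longleftrightarrow> continuous_on S f"
| "cont_diff_on (Suc n) S f \<longleftrightarrow>
     (\<forall>x\<in>S. f differentiable (at x)) \<and> (\<forall>b\<in>Basis. cont_diff_on n S (\<lambda>x. grad f x \<bullet> b))"

definition laplacian :: "('a::euclidean_space \<Rightarrow> real) \<Rightarrow> 'a \<Rightarrow> real" where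
  "laplacian f x = (\<Sum>b\<in>Basis. grad (\<lambda>y. grad f y \<bullet> b) x \<bullet> b)"

definition circle_integral :: "real^2 \<Rightarrow> real \<Rightarrow> (real^2 \<Rightarrow> real) \<Rightarrow> real" where
  "circle_integral x0 r g =
     (LINT \<theta>:{0..2*pi}|lebesgue. g (x0 + r *\<^sub>R vector [cos \<theta>, sin \<theta>]) * r)"

definition ball_integral :: "real^2 \<Rightarrow> real \<Rightarrow> (real^2 \<Rightarrow> real) \<Rightarrow> real" where
  "ball_integral x0 r g = (LINT x:ball x0 r|lebesgue. g x)"


section \<open>Segregated Sobolev functions\<close>

definition test_function :: "('a::euclidean_space \<Rightarrow> real) \<Rightarrow> bool" where
  "test_function \<phi> \<longleftrightarrow>
     (\<forall>n. cont_diff_on n UNIV \<phi>) \<and> (\<exists>K. compact K \<and> (\<forall>x. x \<notin> K \<longrightarrow> \<phi> x = 0))"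

definition L2_loc :: "('a::euclidean_space \<Rightarrow> real) set" where
  "L2_loc = {f. f \<in> borel_measurable lebesgue \<and>
                (\<forall>K. compact K \<longrightarrow> set_integrable lebesgue K (\<lambda>x. (f x)\<^sup>2))}"

definition weak_partial ::
    "('a::euclidean_space \<Rightarrow> real) \<Rightarrow> 'a \<Rightarrow> ('a \<Rightarrow> real) \<Rightarrow> bool" where
  "weak_partial f b g \<longleftrightarrow>
     (\<forall>\<phi>. test_function \<phi> \<longrightarrow>
        (LINT x|lebesgue. f x * (grad \<phi> x \<bullet> b)) = - (LINT x|lebesgue. g x * \<phi> x))"

definition H1_loc :: "('a::euclidean_space \<Rightarrow> real) set" where
  "H1_loc = {f \<in> L2_loc. \<forall>b\<in>Basis. \<exists>g\<in>L2_loc. weak_partial f b g}"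

definition Sigma_set :: "(real^'k) set" where
  "Sigma_set = {\<xi>. (\<Sum>(i,j)\<in>{(i,j). i \<noteq> j}. (\<xi> $ i)\<^sup>2 * (\<xi> $ j)\<^sup>2) = 0}"

definition H1_loc_Sigma :: "(real^2 \<Rightarrow> real^'k) set" where
  "H1_loc_Sigma = {u. (\<forall>i. (\<lambda>x. u x $ i) \<in> H1_loc) \<and> (AE x in lebesgue. u x \<in> Sigma_set)}"

definition two_homogeneous :: "(real^2 \<Rightarrow> real^'k) \<Rightarrow> bool" where
  "two_homogeneous u \<longleftrightarrow> (\<forall>t>0. \<forall>x. u (t *\<^sub>R x) = t\<^sup>2 *\<^sub>R u x)"


section \<open>The class \<open>\<T>\<^sub>\<lambda>\<close>\<close>

definition grad_sq :: "(real^2 \<Rightarrow> real^'k) \<Rightarrow> real^2 \<Rightarrow> real" where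
  "grad_sq u x = (\<Sum>i\<in>UNIV. (norm (grad (\<lambda>y. u y $ i) x))\<^sup>2)"

definition deriv_dir_sq :: "(real^2 \<Rightarrow> real^'k) \<Rightarrow> real^2 \<Rightarrow> real^2 \<Rightarrow> real" where
  "deriv_dir_sq u \<nu> x = (\<Sum>i\<in>UNIV. (grad (\<lambda>y. u y $ i) x \<bullet> \<nu>)\<^sup>2)"

abbreviation spacedim :: nat where
  "spacedim \<equiv> DIM(real^2)"

definition pohozaev_identity ::
    "real^'k \<Rightarrow> (real^2 \<Rightarrow> real^'k) \<Rightarrow> real^2 \<Rightarrow> real \<Rightarrow> bool" where
  "pohozaev_identity lam u x0 r \<longleftrightarrow>
     r * circle_integral x0 r (grad_sq u) =
       (real spacedim - 2) * ball_integral x0 r (grad_sq u)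
       + 2 * r * circle_integral x0 r (\<lambda>x. deriv_dir_sq u ((x - x0) /\<^sub>R r) x)
       + 2 * r * circle_integral x0 r (\<lambda>x. lam \<bullet> u x)
       - 2 * real spacedim * ball_integral x0 r (\<lambda>x. lam \<bullet> u x)"

definition domain :: "(real^2) set \<Rightarrow> bool" where
  "domain A \<longleftrightarrow> open A \<and> connected A \<and> A \<noteq> {}"

text \<open>
  The distance to the empty boundary is \<open>\<infinity>\<close>, whereas \<open>infdist x {} = 0\<close>; hence the case distinction
  in the Pohozaev condition.
\<close>

definition T_class :: "real^'k \<Rightarrow> (real^2) set \<Rightarrow> (real^2 \<Rightarrow> real^'k) set" where
  "T_class lam A = {u.
     (\<exists>x\<in>A. u x \<noteq> 0) \<and>
     (\<forall>x\<in>A. \<forall>i. 0 \<le> u x $ i) \<and>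
     (\<forall>x\<in>A. \<exists>\<rho>>0. \<exists>L. L-lipschitz_on (ball x \<rho> \<inter> A) u) \<and>
     (\<forall>x\<in>A. \<forall>i j. i \<noteq> j \<longrightarrow> u x $ i * u x $ j = 0) \<and>
     (\<forall>i. cont_diff_on 2 {x\<in>A. 0 < u x $ i} (\<lambda>x. u x $ i) \<and>
          (\<forall>x\<in>{x\<in>A. 0 < u x $ i}. - laplacian (\<lambda>y. u y $ i) x = lam $ i)) \<and>
     (\<forall>x0\<in>A. u x0 = 0 \<longrightarrow>
        (\<forall>r>0. frontier A = {} \<or> r < infdist x0 (frontier A) \<longrightarrow> pohozaev_identity lam u x0 r))}"

text \<open>Non-triviality is required globally, but not on those subdomains where \<open>u\<close> vanishes.\<close>

definition T_loc :: "real^'k \<Rightarrow> (real^2 \<Rightarrow> real^'k) set" where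
  "T_loc lam = {u. (\<exists>x. u x \<noteq> 0) \<and>
     (\<forall>A. domain A \<and> compact (closure A) \<and> (\<exists>x\<in>A. u x \<noteq> 0) \<longrightarrow> u \<in> T_class lam A)}"


section \<open>Regular points and the reflection law\<close>

definition zero_set :: "(real^2 \<Rightarrow> real^'k) \<Rightarrow> (real^2) set" where
  "zero_set u = {x. u x = 0}"

definition scaled_norm :: "(real^2 \<Rightarrow> real^'k) \<Rightarrow> real^2 \<Rightarrow> real \<Rightarrow> real" where
  "scaled_norm u x0 r = sqrt (\<Sum>i\<in>UNIV.
     1 / r ^ (spacedim - 2) * ball_integral x0 r (\<lambda>x. (norm (grad (\<lambda>y. u y $ i) x))\<^sup>2)
     + 1 / r ^ (spacedim - 1) * circle_integral x0 r (\<lambda>x. (u x $ i)\<^sup>2))"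

definition vanishing_order :: "(real^2 \<Rightarrow> real^'k) \<Rightarrow> real^2 \<Rightarrow> ereal" where
  "vanishing_order u x0 = (SUP \<gamma>\<in>{\<gamma>::real. 0 < \<gamma> \<and>
     Limsup (at_right 0) (\<lambda>r. ereal (scaled_norm u x0 r / r powr \<gamma>)) < \<infinity>}. ereal \<gamma>)"

definition regular_set :: "(real^2 \<Rightarrow> real^'k) \<Rightarrow> (real^2) set" where
  "regular_set u = {x0 \<in> zero_set u. vanishing_order u x0 = 1}"

text \<open>
  \<open>\<psi>\<close> exhibits \<open>Z\<close> as a \<open>C\<^sup>1\<close> curve in \<open>ball x0 \<rho>\<close>. The normal direction at \<open>x0\<close> is that of its
  gradient, and the two sides of \<open>Z\<close> are \<open>{\<psi> > 0}\<close> and \<open>{\<psi> < 0}\<close>.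
\<close>

definition local_equation :: "(real^2) set \<Rightarrow> real^2 \<Rightarrow> real \<Rightarrow> (real^2 \<Rightarrow> real) \<Rightarrow> bool" where
  "local_equation Z x0 \<rho> \<psi> \<longleftrightarrow>
     0 < \<rho> \<and> x0 \<in> Z \<and> cont_diff_on 1 (ball x0 \<rho>) \<psi> \<and>
     (\<forall>x\<in>ball x0 \<rho>. grad \<psi> x \<noteq> 0 \<and> (x \<in> Z \<longleftrightarrow> \<psi> x = 0))"

definition unit_normal :: "(real^2) set \<Rightarrow> real^2 \<Rightarrow> real^2 \<Rightarrow> bool" where
  "unit_normal Z x0 \<nu> \<longleftrightarrow>
     norm \<nu> = 1 \<and> (\<exists>\<rho> \<psi> c. local_equation Z x0 \<rho> \<psi> \<and> \<nu> = c *\<^sub>R grad \<psi> x0)"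

definition positive_sides :: "(real^2 \<Rightarrow> real^'k) \<Rightarrow> real^2 \<Rightarrow> 'k \<Rightarrow> 'k \<Rightarrow> bool" where
  "positive_sides u x0 i j \<longleftrightarrow>
     i \<noteq> j \<and> (\<exists>\<rho> \<psi>. local_equation (zero_set u) x0 \<rho> \<psi> \<and>
       (\<forall>x\<in>ball x0 \<rho>. (0 < \<psi> x \<longrightarrow> 0 < u x $ i) \<and> (\<psi> x < 0 \<longrightarrow> 0 < u x $ j)))"

text \<open>
  The existence clauses assert that the normal and the indices \<open>i \<noteq> j\<close> the law refers to are there
  at every regular point; the law itself is insensitive to the orientation of \<open>\<nu>\<close> and to the order
  of \<open>i, j\<close>, so it is required for all admissible choices.
\<close>

definition reflection_law :: "(real^2 \<Rightarrow> real^'k) \<Rightarrow> bool" where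
  "reflection_law u \<longleftrightarrow> (\<forall>x0\<in>regular_set u.
     (\<exists>\<nu>. unit_normal (zero_set u) x0 \<nu>) \<and>
     (\<exists>i j. positive_sides u x0 i j) \<and>
     (\<forall>\<nu> i j. unit_normal (zero_set u) x0 \<nu> \<and> positive_sides u x0 i j \<longrightarrow>
        (\<exists>l. ((\<lambda>x. grad (\<lambda>y. u y $ i) x \<bullet> \<nu>) \<longlongrightarrow> l) (at x0 within {x. 0 < u x $ i}) \<and>
             ((\<lambda>x. grad (\<lambda>y. u y $ j) x \<bullet> \<nu>) \<longlongrightarrow> - l) (at x0 within {x. 0 < u x $ j}))))"

end

theory Submission
  imports Defs
begin

text \<open>
  Two components suffice. With \<open>L = \<lambda>\<^sub>i + \<lambda>\<^sub>j\<close>, \<open>c\<^sup>2 = \<lambda>\<^sub>i / L\<close>, \<open>s\<^sup>2 = \<lambda>\<^sub>j / L\<close> put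
  \<open>u\<^sub>i = (L c / 4) (\<bar>A\<bar> - c \<bar>x\<bar>\<^sup>2)\<^sup>+\<close> and \<open>u\<^sub>j = (L s / 4) (\<bar>B\<bar> - s \<bar>x\<bar>\<^sup>2)\<^sup>+\<close>, where
  \<open>A + \<i> B\<close> is a rotation of \<open>(x\<^sub>1 + \<i> x\<^sub>2)\<^sup>2\<close>. Since \<open>A\<^sup>2 + B\<^sup>2 = \<bar>x\<bar>\<^sup>4\<close> and \<open>c\<^sup>2 + s\<^sup>2 = 1\<close>, the quartic
  \<open>\<psi> = A\<^sup>2 - c\<^sup>2 \<bar>x\<bar>\<^sup>4\<close> is positive exactly where \<open>u\<^sub>i > 0\<close> and negative exactly where \<open>u\<^sub>j > 0\<close>, and
  its zero set consists of four lines through the origin. On these lines the gradients of \<open>u\<^sub>i\<close> and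
  \<open>- u\<^sub>j\<close> agree, so \<open>v = u\<^sub>i - u\<^sub>j\<close> is a \<open>C\<^sup>1\<close>, piecewise quadratic function with
  \<open>- \<Delta>v = \<lambda>\<^sub>i 1\<^bsub>v > 0\<^esub> - \<lambda>\<^sub>j 1\<^bsub>v < 0\<^esub>\<close>. The Pohozaev identity for \<open>v\<close> is the divergence theorem
  on the disc for a Lipschitz field, and follows from Fubini's theorem because every line parallel to
  an axis crosses the nodal lines finitely often. The origin has vanishing order at least two, hence
  is not regular. The rotation angle is a free parameter, which gives infinitely many functions.
\<close>

section \<open>The divergence theorem on a disc\<close>

lemma Basis_real2: "(Basis :: (real^2) set) = {axis 1 1, axis 2 1}"
  by (auto simp: Basis_vec_def UNIV_2)

lemma plane_eq_iff: "x = y \<longleftrightarrow> x $ 1 = y $ 1 \<and> x $ 2 = (y $ 2 :: real)" for x y :: "real^2"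
  by (simp add: vec_eq_iff forall_2)

lemma inner_plane: "x \<bullet> y = x $ 1 * y $ 1 + x $ 2 * y $ 2" for x y :: "real^2"
  by (simp add: inner_vec_def sum_2)

lemma mem_ball_plane:
  "x \<in> ball x0 r \<longleftrightarrow> (x $ 1 - x0 $ 1)\<^sup>2 + (x $ 2 - x0 $ 2)\<^sup>2 < r\<^sup>2" if "0 < r" for x :: "real^2"
proof -
  have "dist x0 x = sqrt ((x $ 1 - x0 $ 1)\<^sup>2 + (x $ 2 - x0 $ 2)\<^sup>2)"
    by (simp add: dist_norm norm_eq_sqrt_inner inner_plane power2_eq_square algebra_simps)
  moreover have "sqrt A < r \<longleftrightarrow> A < r\<^sup>2" for A
    using that real_sqrt_less_iff[of A "r\<^sup>2"] by simp
  ultimately show ?thesis by simp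
qed

lemma continuous_on_vector2 [continuous_intros]:
  fixes f g :: "'a::topological_space \<Rightarrow> real"
  assumes "continuous_on S f" "continuous_on S g"
  shows "continuous_on S (\<lambda>x. vector [f x, g x] :: real^2)"
proof -
  have "(\<lambda>x. vector [f x, g x] :: real^2) = (\<lambda>x. f x *\<^sub>R axis 1 1 + g x *\<^sub>R axis 2 1)"
    by (auto simp: fun_eq_iff plane_eq_iff axis_def)
  moreover have "continuous_on S (\<lambda>x. f x *\<^sub>R axis 1 1 + g x *\<^sub>R axis 2 1 :: real^2)"
    using assms by (intro continuous_intros)
  ultimately show ?thesis
    by metis
qed

lemma measurable_vector2 [measurable]:
  "(\<lambda>p. vector [fst p, snd p] :: real^2) \<in> borel_measurable borel"
  "(\<lambda>p. vector [snd p, fst p] :: real^2) \<in> borel_measurable borel"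
  by (intro borel_measurable_continuous_onI continuous_intros)+

text \<open>Both image measures agree with Lebesgue measure on boxes, which determines it. The
  swapped form yields the other order of integration in \<open>fubini_plane\<close>, so that each
  component of a field can be integrated first along its own direction.\<close>

lemma lborel_plane:
  "lborel = distr (lborel \<Otimes>\<^sub>M lborel) borel (\<lambda>p. vector [fst p, snd p] :: real^2)" (is ?A)
  "lborel = distr (lborel \<Otimes>\<^sub>M lborel) borel (\<lambda>p. vector [snd p, fst p] :: real^2)" (is ?B)
proof -
  have ne: "axis 1 (1::real) \<noteq> (axis 2 1 :: real^2)"
    by (simp add: axis_eq_axis)
  have box: "x \<in> box l u \<longleftrightarrow> l$1 < x$1 \<and> x$1 < u$1 \<and> l$2 < x$2 \<and> x$2 < u$2" for x l u :: "real^2"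
    by (auto simp: mem_box Basis_real2 inner_axis)
  have le: "l $ 1 \<le> u $ 1" "l $ 2 \<le> u $ 2"
    if "\<And>b. b \<in> Basis \<Longrightarrow> l \<bullet> b \<le> u \<bullet> b" for l u :: "real^2"
    using that[of "axis 1 1"] that[of "axis 2 1"] by (simp_all add: Basis_real2 inner_axis)
  have pr: "(\<Prod>b\<in>Basis. (u - l) \<bullet> b) = (u $ 1 - l $ 1) * (u $ 2 - l $ 2)" for l u :: "real^2"
    using ne by (simp add: Basis_real2 inner_axis)
  have m: "(\<lambda>p. vector [fst p, snd p] :: real^2) \<in> (lborel \<Otimes>\<^sub>M lborel) \<rightarrow>\<^sub>M borel"
    "(\<lambda>p. vector [snd p, fst p] :: real^2) \<in> (lborel \<Otimes>\<^sub>M lborel) \<rightarrow>\<^sub>M borel"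
    using measurable_vector2 by (simp_all add: lborel_prod)
  show ?A
  proof (rule lborel_eqI)
    fix l u :: "real^2" assume *: "\<And>b. b \<in> Basis \<Longrightarrow> l \<bullet> b \<le> u \<bullet> b"
    have "(\<lambda>p. vector [fst p, snd p] :: real^2) -` box l u \<inter> space (lborel \<Otimes>\<^sub>M lborel)
        = {l$1<..<u$1} \<times> {l$2<..<u$2}"
      by (auto simp: box space_pair_measure)
    then show "emeasure (distr (lborel \<Otimes>\<^sub>M lborel) borel (\<lambda>p. vector [fst p, snd p] :: real^2)) (box l u)
        = (\<Prod>b\<in>Basis. (u - l) \<bullet> b)"
      using le[OF *] m
      by (simp add: emeasure_distr pr lborel.emeasure_pair_measure_Times ennreal_mult)
  qed simp
  show ?B
  proof (rule lborel_eqI)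
    fix l u :: "real^2" assume *: "\<And>b. b \<in> Basis \<Longrightarrow> l \<bullet> b \<le> u \<bullet> b"
    have "(\<lambda>p. vector [snd p, fst p] :: real^2) -` box l u \<inter> space (lborel \<Otimes>\<^sub>M lborel)
        = {l$2<..<u$2} \<times> {l$1<..<u$1}"
      by (auto simp: box space_pair_measure)
    then show "emeasure (distr (lborel \<Otimes>\<^sub>M lborel) borel (\<lambda>p. vector [snd p, fst p] :: real^2)) (box l u)
        = (\<Prod>b\<in>Basis. (u - l) \<bullet> b)"
      using le[OF *] m
      by (simp add: emeasure_distr pr lborel.emeasure_pair_measure_Times ennreal_mult mult.commute)
  qed simp
qed

lemma fubini_plane:
  fixes f :: "real^2 \<Rightarrow> real"
  assumes "integrable lborel f"
  shows "integral\<^sup>L lborel f = (LINT a|lborel. LINT b|lborel. f (vector [a, b]))"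
    "integral\<^sup>L lborel f = (LINT b|lborel. LINT a|lborel. f (vector [a, b]))"
proof -
  have f: "f \<in> borel_measurable borel"
    using assms by simp
  have m: "(\<lambda>p. vector [fst p, snd p] :: real^2) \<in> (lborel \<Otimes>\<^sub>M lborel) \<rightarrow>\<^sub>M borel"
    "(\<lambda>p. vector [snd p, fst p] :: real^2) \<in> (lborel \<Otimes>\<^sub>M lborel) \<rightarrow>\<^sub>M borel"
    using measurable_vector2 by (simp_all add: lborel_prod)
  have "integrable (lborel \<Otimes>\<^sub>M lborel) (\<lambda>p. f (vector [fst p, snd p]))"
    using assms unfolding lborel_plane(1) by (simp add: integrable_distr_eq m f)
  from lborel_pair.integral_fst'[OF this] integral_distr[OF m(1) f]
  show "integral\<^sup>L lborel f = (LINT a|lborel. LINT b|lborel. f (vector [a, b]))"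
    by (simp add: lborel_plane(1)[symmetric])
  have "integrable (lborel \<Otimes>\<^sub>M lborel) (\<lambda>p. f (vector [snd p, fst p]))"
    using assms unfolding lborel_plane(2) by (simp add: integrable_distr_eq m f)
  from lborel_pair.integral_fst'[OF this] integral_distr[OF m(2) f]
  show "integral\<^sup>L lborel f = (LINT b|lborel. LINT a|lborel. f (vector [a, b]))"
    by (simp add: lborel_plane(2)[symmetric])
qed

lemma set_integral_lebesgue_continuous:
  fixes f :: "real \<Rightarrow> real"
  assumes "continuous_on {a..b} f"
  shows "(LINT x:{a..b}|lebesgue. f x) = integral {a..b} f"
  using assms
  by (intro set_lebesgue_integral_eq_integral(2) absolutely_integrable_continuous_real)

lemma set_integral_lborel_continuous:
  fixes f :: "real \<Rightarrow> real"
  assumes "continuous_on {a..b} f"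
  shows "(LINT x:{a..b}|lborel. f x) = integral {a..b} f"
  using assms borel_integrable_atLeastAtMost'[of a b f]
  by (intro set_borel_integral_eq_integral(2)) 

section \<open>The flux of a coordinate field through a circle and the divergence theorem\<close>

lemma circle_integral_eq_integral:
  assumes "continuous_on UNIV h"
  shows "circle_integral x0 r h
    = integral {0..2*pi} (\<lambda>\<theta>. h (x0 + r *\<^sub>R vector [cos \<theta>, sin \<theta>]) * r)"
  unfolding circle_integral_def
  by (intro set_integral_lebesgue_continuous continuous_intros
        continuous_on_compose2[OF assms]) auto

text \<open>Substitute y = b + r sin \<theta>. Where cos \<theta> is nonnegative the circle point is
  the right end of the horizontal chord at height y, elsewhere the left end. As the parametrization
  starts inside the right half circle, that half is made up of two pieces.\<close>

lemma circle_flux_horizontal: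
  fixes h :: "real^2 \<Rightarrow> real"
  assumes h: "continuous_on UNIV h" and r: "0 < r"
  shows "circle_integral x0 r (\<lambda>x. h x * ((x - x0) $ 1 / r))
    = integral {x0 $ 2 - r..x0 $ 2 + r} (\<lambda>y.
        h (vector [x0 $ 1 + sqrt (r\<^sup>2 - (y - x0 $ 2)\<^sup>2), y])
      - h (vector [x0 $ 1 - sqrt (r\<^sup>2 - (y - x0 $ 2)\<^sup>2), y]))"
proof -
  define a b where "a = x0 $ 1" and "b = x0 $ 2"
  define R where "R y = h (vector [a + sqrt (r\<^sup>2 - (y - b)\<^sup>2), y])" for y
  define L where "L y = h (vector [a - sqrt (r\<^sup>2 - (y - b)\<^sup>2), y])" for y
  define g where "g \<theta> = b + r * sin \<theta>" for \<theta>
  define H where "H \<theta> = h (x0 + r *\<^sub>R vector [cos \<theta>, sin \<theta>])" for \<theta>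
  have cR: "continuous_on S R" and cL: "continuous_on S L" for S
    unfolding R_def L_def by (intro continuous_intros continuous_on_compose2[OF h]; simp)+
  have iR: "R integrable_on {p..q}" and iL: "L integrable_on {p..q}" for p q
    by (auto intro!: integrable_continuous_real cR cL)
  have sq: "r\<^sup>2 - (g \<theta> - b)\<^sup>2 = (r * cos \<theta>)\<^sup>2" for \<theta>
    using sin_cos_squared_add[of \<theta>] unfolding g_def by algebra
  have pt: "x0 + r *\<^sub>R vector [cos \<theta>, sin \<theta>] = vector [a + r * cos \<theta>, g \<theta>]" for \<theta>
    by (simp add: plane_eq_iff a_def b_def g_def)
  have HR: "H \<theta> = R (g \<theta>)" if "cos \<theta> \<ge> 0" for \<theta>
    using that r unfolding H_def R_def sq pt by simp
  have HL: "H \<theta> = L (g \<theta>)" if "cos \<theta> \<le> 0" for \<theta>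
    using that r mult_nonneg_nonpos[of r "cos \<theta>"] unfolding H_def L_def sq pt by simp
  \<comment> \<open>The difference of two integrals is an oriented integral: for
    \<open>g p \<le> g q\<close> the second term vanishes, otherwise the first one does. Hence one
    formula serves increasing and decreasing pieces.\<close>
  have sub: "((\<lambda>\<theta>. (r * cos \<theta>) *\<^sub>R f (g \<theta>)) has_integral
      (integral {g p..g q} f - integral {g q..g p} f)) {p..q}"
    if "p \<le> q" "continuous_on {b - r..b + r} f" for p q and f :: "real \<Rightarrow> real"
  proof (rule has_integral_substitution_general[OF finite.emptyI that(1) _ that(2)])
    show "g ` {p..q} \<subseteq> {b - r..b + r}"
      using r abs_sin_le_one by (force simp: g_def mult_le_cancel_left1 abs_le_iff
         intro: order_trans[OF _ mult_left_mono[of "-1" "sin _" r]])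
    show "continuous_on {p..q} g"
      unfolding g_def by (intro continuous_intros)
    show "(g has_real_derivative r * cos \<theta>) (at \<theta> within {p..q})" for \<theta>
      unfolding g_def by (auto intro!: derivative_eq_intros)
  qed
  have g0: "g 0 = b" "g (pi/2) = b + r" "g (3*pi/2) = b - r" "g (2*pi) = b"
    using sin_3over2_pi by (simp_all add: g_def)
  have i1: "((\<lambda>\<theta>. (r * cos \<theta>) *\<^sub>R H \<theta>) has_integral integral {b..b + r} R) {0..pi/2}"
  proof (rule has_integral_eq)
    show "((\<lambda>\<theta>. (r * cos \<theta>) *\<^sub>R R (g \<theta>)) has_integral integral {b..b + r} R) {0..pi/2}"
      using sub[of 0 "pi/2" R] cR r by (simp add: g0)
  qed (use HR in \<open>simp add: cos_ge_zero\<close>)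
  have c2: "cos \<theta> \<le> 0" if "\<theta> \<in> {pi/2..3*pi/2}" for \<theta>
    using cos_ge_zero[of "\<theta> - pi"] that by simp
  have i2: "((\<lambda>\<theta>. (r * cos \<theta>) *\<^sub>R H \<theta>) has_integral - integral {b - r..b + r} L) {pi/2..3*pi/2}"
  proof (rule has_integral_eq)
    show "((\<lambda>\<theta>. (r * cos \<theta>) *\<^sub>R L (g \<theta>)) has_integral - integral {b - r..b + r} L) {pi/2..3*pi/2}"
      using sub[of "pi/2" "3*pi/2" L] cL r by (simp add: g0)
  qed (use HL c2 in simp)
  have c3: "cos \<theta> \<ge> 0" if "\<theta> \<in> {3*pi/2..2*pi}" for \<theta>
    using cos_ge_zero[of "\<theta> - 2*pi"] that by (simp add: cos_diff)
  have i3: "((\<lambda>\<theta>. (r * cos \<theta>) *\<^sub>R H \<theta>) has_integral integral {b - r..b} R) {3*pi/2..2*pi}"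
  proof (rule has_integral_eq)
    show "((\<lambda>\<theta>. (r * cos \<theta>) *\<^sub>R R (g \<theta>)) has_integral integral {b - r..b} R) {3*pi/2..2*pi}"
      using sub[of "3*pi/2" "2*pi" R] cR r by (simp add: g0)
  qed (use HR c3 in simp)
  have "((\<lambda>\<theta>. (r * cos \<theta>) *\<^sub>R H \<theta>) has_integral
      integral {b..b + r} R + - integral {b - r..b + r} L + integral {b - r..b} R) {0..2*pi}"
    by (rule has_integral_combine[OF _ _ has_integral_combine[OF _ _ i1 i2] i3]) auto
  moreover have "integral {b - r..b} R + integral {b..b + r} R = integral {b - r..b + r} R"
    using r iR by (intro Henstock_Kurzweil_Integration.integral_combine) auto
  ultimately have "integral {0..2*pi} (\<lambda>\<theta>. (r * cos \<theta>) *\<^sub>R H \<theta>)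
      = integral {b - r..b + r} R - integral {b - r..b + r} L"
    by (simp add: integral_unique)
  also have "\<dots> = integral {b - r..b + r} (\<lambda>y. R y - L y)"
    using iR iL by (simp add: Henstock_Kurzweil_Integration.integral_diff)
  finally have "integral {0..2*pi} (\<lambda>\<theta>. (r * cos \<theta>) *\<^sub>R H \<theta>) = integral {b - r..b + r} (\<lambda>y. R y - L y)" .
  moreover have "circle_integral x0 r (\<lambda>x. h x * ((x - x0) $ 1 / r))
      = integral {0..2*pi} (\<lambda>\<theta>. (r * cos \<theta>) *\<^sub>R H \<theta>)"
    using r by (subst circle_integral_eq_integral)
      (auto intro!: continuous_intros h continuous_on_component simp: H_def mult_ac)
  ultimately show ?thesis
    by (simp add: R_def L_def a_def b_def)
qed

text \<open>Here the substitution is y = a + r cos \<theta>, and the upper and lower half circles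
  are the parameter intervals from 0 to pi and from pi to 2 pi. The substitution produces - r sin
  \<theta>, so the sign is reversed at the end.\<close>

lemma circle_flux_vertical:
  fixes h :: "real^2 \<Rightarrow> real"
  assumes h: "continuous_on UNIV h" and r: "0 < r"
  shows "circle_integral x0 r (\<lambda>x. h x * ((x - x0) $ 2 / r))
    = integral {x0 $ 1 - r..x0 $ 1 + r} (\<lambda>y.
        h (vector [y, x0 $ 2 + sqrt (r\<^sup>2 - (y - x0 $ 1)\<^sup>2)])
      - h (vector [y, x0 $ 2 - sqrt (r\<^sup>2 - (y - x0 $ 1)\<^sup>2)]))"
proof -
  define a b where "a = x0 $ 1" and "b = x0 $ 2"
  define R where "R y = h (vector [y, b + sqrt (r\<^sup>2 - (y - a)\<^sup>2)])" for y
  define L where "L y = h (vector [y, b - sqrt (r\<^sup>2 - (y - a)\<^sup>2)])" for y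
  define g where "g \<theta> = a + r * cos \<theta>" for \<theta>
  define H where "H \<theta> = h (x0 + r *\<^sub>R vector [cos \<theta>, sin \<theta>])" for \<theta>
  have cR: "continuous_on S R" and cL: "continuous_on S L" for S
    unfolding R_def L_def by (intro continuous_intros continuous_on_compose2[OF h]; simp)+
  have iR: "R integrable_on {p..q}" and iL: "L integrable_on {p..q}" for p q
    by (auto intro!: integrable_continuous_real cR cL)
  have sq: "r\<^sup>2 - (g \<theta> - a)\<^sup>2 = (r * sin \<theta>)\<^sup>2" for \<theta>
    using sin_cos_squared_add[of \<theta>] unfolding g_def by algebra
  have pt: "x0 + r *\<^sub>R vector [cos \<theta>, sin \<theta>] = vector [g \<theta>, b + r * sin \<theta>]" for \<theta>
    by (simp add: plane_eq_iff a_def b_def g_def)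
  have HR: "H \<theta> = R (g \<theta>)" if "sin \<theta> \<ge> 0" for \<theta>
    using that r unfolding H_def R_def sq pt by simp
  have HL: "H \<theta> = L (g \<theta>)" if "sin \<theta> \<le> 0" for \<theta>
    using that r mult_nonneg_nonpos[of r "sin \<theta>"] unfolding H_def L_def sq pt by simp
  have sub: "((\<lambda>\<theta>. (- r * sin \<theta>) *\<^sub>R f (g \<theta>)) has_integral
      (integral {g p..g q} f - integral {g q..g p} f)) {p..q}"
    if "p \<le> q" "continuous_on {a - r..a + r} f" for p q and f :: "real \<Rightarrow> real"
  proof (rule has_integral_substitution_general[OF finite.emptyI that(1) _ that(2)])
    show "g ` {p..q} \<subseteq> {a - r..a + r}"
      using r abs_cos_le_one by (force simp: g_def mult_le_cancel_left1 abs_le_iff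
         intro: order_trans[OF _ mult_left_mono[of "-1" "cos _" r]])
    show "continuous_on {p..q} g"
      unfolding g_def by (intro continuous_intros)
    show "(g has_real_derivative - r * sin \<theta>) (at \<theta> within {p..q})" for \<theta>
      unfolding g_def by (auto intro!: derivative_eq_intros)
  qed
  have g0: "g 0 = a + r" "g pi = a - r" "g (2*pi) = a + r"
    by (simp_all add: g_def)
  have i1: "((\<lambda>\<theta>. (- r * sin \<theta>) *\<^sub>R H \<theta>) has_integral - integral {a - r..a + r} R) {0..pi}"
  proof (rule has_integral_eq)
    show "((\<lambda>\<theta>. (- r * sin \<theta>) *\<^sub>R R (g \<theta>)) has_integral - integral {a - r..a + r} R) {0..pi}"
      using sub[of 0 pi R] cR r by (simp add: g0)
  qed (use HR in \<open>simp add: sin_ge_zero\<close>)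
  have c2: "sin \<theta> \<le> 0" if "\<theta> \<in> {pi..2*pi}" for \<theta>
    using sin_ge_zero[of "\<theta> - pi"] that by simp
  have i2: "((\<lambda>\<theta>. (- r * sin \<theta>) *\<^sub>R H \<theta>) has_integral integral {a - r..a + r} L) {pi..2*pi}"
  proof (rule has_integral_eq)
    show "((\<lambda>\<theta>. (- r * sin \<theta>) *\<^sub>R L (g \<theta>)) has_integral integral {a - r..a + r} L) {pi..2*pi}"
      using sub[of pi "2*pi" L] cL r by (simp add: g0)
  qed (use HL c2 in simp)
  have "((\<lambda>\<theta>. (- r * sin \<theta>) *\<^sub>R H \<theta>) has_integral
      - integral {a - r..a + r} R + integral {a - r..a + r} L) {0..2*pi}"
    by (rule has_integral_combine[OF _ _ i1 i2]) auto
  then have "((\<lambda>\<theta>. (r * sin \<theta>) *\<^sub>R H \<theta>) has_integral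
      integral {a - r..a + r} R - integral {a - r..a + r} L) {0..2*pi}"
    by (drule_tac has_integral_neg) simp
  then have "integral {0..2*pi} (\<lambda>\<theta>. (r * sin \<theta>) *\<^sub>R H \<theta>)
      = integral {a - r..a + r} R - integral {a - r..a + r} L"
    by (rule integral_unique)
  also have "\<dots> = integral {a - r..a + r} (\<lambda>y. R y - L y)"
    using iR iL by (simp add: Henstock_Kurzweil_Integration.integral_diff)
  finally have "integral {0..2*pi} (\<lambda>\<theta>. (r * sin \<theta>) *\<^sub>R H \<theta>) = integral {a - r..a + r} (\<lambda>y. R y - L y)" .
  moreover have "circle_integral x0 r (\<lambda>x. h x * ((x - x0) $ 2 / r))
      = integral {0..2*pi} (\<lambda>\<theta>. (r * sin \<theta>) *\<^sub>R H \<theta>)"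
    using r by (subst circle_integral_eq_integral)
      (auto intro!: continuous_intros h continuous_on_component simp: H_def mult_ac)
  ultimately show ?thesis
    by (simp add: R_def L_def a_def b_def)
qed

text \<open>The fundamental theorem of calculus on the chord that a line at distance |e| from the
  centre cuts out of the disc. A continuous primitive tolerates finitely many points without
  derivative, and these will be the crossings with the nodal lines.\<close>

lemma chord_integral:
  fixes F D :: "real \<Rightarrow> real"
  assumes F: "continuous_on UNIV F" and S: "finite S"
    and F': "\<And>t. t \<notin> S \<Longrightarrow> (F has_real_derivative D t) (at t)"
    and D: "D \<in> borel_measurable borel" "\<And>t. (t - a)\<^sup>2 + e\<^sup>2 < r\<^sup>2 \<Longrightarrow> \<bar>D t\<bar> \<le> C"
    and r: "0 < r"
  shows "(LINT t|lborel. (if (t - a)\<^sup>2 + e\<^sup>2 < r\<^sup>2 then D t else 0))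
    = (if \<bar>e\<bar> \<le> r then F (a + sqrt (r\<^sup>2 - e\<^sup>2)) - F (a - sqrt (r\<^sup>2 - e\<^sup>2)) else 0)"
proof (cases "\<bar>e\<bar> < r")
  case True
  define l where "l = sqrt (r\<^sup>2 - e\<^sup>2)"
  have e: "e\<^sup>2 < r\<^sup>2"
    using True r power_strict_mono[of "\<bar>e\<bar>" r 2] by simp
  then have l: "0 < l" "l\<^sup>2 = r\<^sup>2 - e\<^sup>2"
    by (simp_all add: l_def)
  have iff: "(t - a)\<^sup>2 + e\<^sup>2 < r\<^sup>2 \<longleftrightarrow> t \<in> {a - l<..<a + l}" for t
  proof -
    have "(t - a)\<^sup>2 + e\<^sup>2 < r\<^sup>2 \<longleftrightarrow> \<bar>t - a\<bar>\<^sup>2 < l\<^sup>2"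
      using l by auto
    also have "\<dots> \<longleftrightarrow> \<bar>t - a\<bar> < l"
      using l(1) by (metis abs_ge_zero abs_less_iff less_eq_real_def power2_less_imp_less power_strict_mono zero_less_numeral)
    finally show ?thesis by auto
  qed
  have "(LINT t|lborel. (if (t - a)\<^sup>2 + e\<^sup>2 < r\<^sup>2 then D t else 0))
      = (LINT t:{a - l<..<a + l}|lborel. D t)"
    unfolding set_lebesgue_integral_def iff
    by (intro Bochner_Integration.integral_cong) auto
  also have "\<dots> = integral {a - l<..<a + l} D"
  proof (rule set_borel_integral_eq_integral)
    show "set_integrable lborel {a - l<..<a + l} D"
      unfolding set_integrable_def
    proof (rule integrableI_bounded_set[where A="{a - l<..<a + l}" and B=C])
      show "AE x in lborel. x \<in> {a - l<..<a + l} \<longrightarrow>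
          norm (indicat_real {a - l<..<a + l} x *\<^sub>R D x) \<le> C"
        using D(2) by (auto simp: iff simp del: greaterThanLessThan_iff)
    qed (use D l in \<open>auto\<close>)
  qed
  also have "\<dots> = integral {a - l..a + l} D"
    by (simp add: integral_open_interval_real)
  also have "\<dots> = F (a + l) - F (a - l)"
    using l F'
    by (intro integral_unique fundamental_theorem_of_calculus_interior_strong[OF S])
      (auto simp: has_real_derivative_iff_has_vector_derivative intro: continuous_on_subset[OF F])
  finally show ?thesis
    using True by (simp add: l_def)
next
  case False
  then have "r\<^sup>2 \<le> e\<^sup>2"
    using r by (metis abs_le_square_iff abs_of_pos not_less)
  then have "\<not> (t - a)\<^sup>2 + e\<^sup>2 < r\<^sup>2" for t
    by (smt (verit) zero_le_power2)
  \<comment> \<open>For a tangent line, |e| = r, the chord shrinks to a point and the two values of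
    \<open>F\<close> cancel.\<close>
  moreover have "sqrt (r\<^sup>2 - e\<^sup>2) = 0" if "\<bar>e\<bar> \<le> r"
    using that False by (metis abs_of_pos diff_self not_less order_antisym_conv power2_abs real_sqrt_zero)
  ultimately show ?thesis by simp
qed

lemma ball_integral_lborel:
  assumes "f \<in> borel_measurable borel"
  shows "ball_integral x0 r f = (LINT x|lborel. indicator (ball x0 r) x * f x)"
  unfolding ball_integral_def set_lebesgue_integral_def
  using assms by (subst integral_completion) (auto intro!: borel_measurable_times borel_measurable_indicator)

lemma integrable_ball_bounded:
  fixes f :: "real^2 \<Rightarrow> real"
  assumes "f \<in> borel_measurable borel" "\<And>x. x \<in> ball x0 r \<Longrightarrow> \<bar>f x\<bar> \<le> C"
  shows "integrable lborel (\<lambda>x. indicator (ball x0 r) x * f x)"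
proof (rule integrableI_bounded_set[where A="ball x0 r" and B=C])
  show "emeasure lborel (ball x0 r) < \<infinity>"
    using emeasure_bounded_finite[OF bounded_ball, of x0 r] by (simp add: infinity_ennreal_def)
qed (use assms in \<open>auto simp: indicator_def\<close>)

text \<open>Fubini's theorem reduces the disc integral to lines parallel to the axis
  \<open>i\<close>. Each of them meets \<open>S\<close> finitely often, so
  \<open>chord_integral\<close> gives the difference of \<open>h\<close> at the chord ends, and
  integrating these differences gives the flux through the circle.\<close>

lemma divergence_disc:
  fixes h :: "real^2 \<Rightarrow> real" and i :: 2
  assumes h: "continuous_on UNIV h"
    and h': "\<And>x. x \<notin> S \<Longrightarrow> (h has_derivative h' x) (at x)"
    and S: "\<And>x. finite {t. x + t *\<^sub>R axis i 1 \<in> S}"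
    and d: "d \<in> borel_measurable borel" "\<And>x. x \<in> ball x0 r \<Longrightarrow> \<bar>d x\<bar> \<le> C"
    and dh: "\<And>x. x \<notin> S \<Longrightarrow> d x = h' x (axis i 1)"
    and r: "0 < r"
  shows "ball_integral x0 r d = circle_integral x0 r (\<lambda>x. h x * ((x - x0) $ i / r))"
proof -
  define a b where "a = x0 $ 1" and "b = x0 $ 2"
  have int: "integrable lborel (\<lambda>x. indicator (ball x0 r) x * d x)"
    using d by (rule integrable_ball_bounded)
  have ind: "indicator (ball x0 r) x * d x = (if (x$1 - a)\<^sup>2 + (x$2 - b)\<^sup>2 < r\<^sup>2 then d x else 0)" for x
    using r by (simp add: mem_ball_plane a_def b_def indicator_def del: mem_ball)
  have line: "((\<lambda>t. h (x + t *\<^sub>R axis i 1)) has_real_derivative d (x + t *\<^sub>R axis i 1)) (at t)"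
    if "x + t *\<^sub>R axis i 1 \<notin> S" for x t
  proof -
    have "((\<lambda>t. h (x + t *\<^sub>R axis i 1)) has_derivative
        (\<lambda>s. h' (x + t *\<^sub>R axis i 1) (s *\<^sub>R axis i 1))) (at t)"
      by (rule has_derivative_compose[of "\<lambda>t. x + t *\<^sub>R axis i 1" _ _ _ h, OF _ h'[OF that]])
        (auto intro!: derivative_eq_intros)
    moreover have "h' (x + t *\<^sub>R axis i 1) (s *\<^sub>R axis i 1) = d (x + t *\<^sub>R axis i 1) * s" for s
      using linear_scale[OF has_derivative_linear[OF h'[OF that]], of s "axis i 1"] dh[OF that] by simp
    ultimately show ?thesis
      by (simp add: has_field_derivative_def)
  qed
  have mv: "(\<lambda>t::real. vector [t, y] :: real^2) \<in> borel_measurable borel"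
    "(\<lambda>t::real. vector [y, t] :: real^2) \<in> borel_measurable borel" for y
    by (auto intro!: borel_measurable_continuous_onI continuous_intros)
  consider "i = 1" | "i = 2"
    using exhaust_2 by blast
  then show ?thesis
  proof cases
    case 1
    have eq: "vector [t, y] = vector [0, y] + t *\<^sub>R (axis 1 1 :: real^2)" for t y
      by (simp add: plane_eq_iff axis_def)
    define G where "G y = h (vector [a + sqrt (r\<^sup>2 - (y - b)\<^sup>2), y]) - h (vector [a - sqrt (r\<^sup>2 - (y - b)\<^sup>2), y])" for y
    have G: "continuous_on T G" for T
      unfolding G_def by (intro continuous_intros continuous_on_compose2[OF h]; simp)
    have chord: "(LINT t|lborel. indicator (ball x0 r) (vector [t, y]) * d (vector [t, y]))
        = (if \<bar>y - b\<bar> \<le> r then G y else 0)" for y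
      unfolding ind vector_2 G_def
    proof (rule chord_integral[where F="\<lambda>t. h (vector [t, y])" and D="\<lambda>t. d (vector [t, y])"])
      show "continuous_on UNIV (\<lambda>t. h (vector [t, y]))"
        by (intro continuous_intros continuous_on_compose2[OF h]; simp)
      show "finite {t. vector [0, y] + t *\<^sub>R axis 1 1 \<in> S}"
        using S 1 by simp
      show "((\<lambda>t. h (vector [t, y])) has_real_derivative d (vector [t, y])) (at t)"
        if "t \<notin> {t. vector [0, y] + t *\<^sub>R axis 1 1 \<in> S}" for t
        using line[of "vector [0, y]" t] that unfolding eq[symmetric] 1 by simp
      show "(\<lambda>t. d (vector [t, y])) \<in> borel_measurable borel"
        using measurable_compose[OF mv(1) d(1)] .
      show "\<bar>d (vector [t, y])\<bar> \<le> C" if "(t - a)\<^sup>2 + (y - b)\<^sup>2 < r\<^sup>2" for t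
        using that r by (intro d) (simp add: mem_ball_plane a_def b_def del: mem_ball)
    qed fact
    have "ball_integral x0 r d = (LINT y|lborel. (if \<bar>y - b\<bar> \<le> r then G y else 0))"
      unfolding ball_integral_lborel[OF d(1)] fubini_plane(2)[OF int] chord ..
    also have "\<dots> = (LINT y:{b - r..b + r}|lborel. G y)"
      unfolding set_lebesgue_integral_def
      by (intro Bochner_Integration.integral_cong) (auto simp: indicator_def abs_le_iff)
    also have "\<dots> = integral {b - r..b + r} G"
      by (intro set_integral_lborel_continuous G)
    finally show ?thesis
      using circle_flux_horizontal[OF h r, of x0] 1 by (simp add: G_def[abs_def] a_def b_def)
  next
    case 2
    have eq: "vector [y, t] = vector [y, 0] + t *\<^sub>R (axis 2 1 :: real^2)" for t y
      by (simp add: plane_eq_iff axis_def)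
    define G where "G y = h (vector [y, b + sqrt (r\<^sup>2 - (y - a)\<^sup>2)]) - h (vector [y, b - sqrt (r\<^sup>2 - (y - a)\<^sup>2)])" for y
    have G: "continuous_on T G" for T
      unfolding G_def by (intro continuous_intros continuous_on_compose2[OF h]; simp)
    have chord: "(LINT t|lborel. indicator (ball x0 r) (vector [y, t]) * d (vector [y, t]))
        = (if \<bar>y - a\<bar> \<le> r then G y else 0)" for y
      unfolding ind vector_2 G_def add.commute[of "(y - a)\<^sup>2"]
    proof (rule chord_integral[where F="\<lambda>t. h (vector [y, t])" and D="\<lambda>t. d (vector [y, t])"])
      show "continuous_on UNIV (\<lambda>t. h (vector [y, t]))"
        by (intro continuous_intros continuous_on_compose2[OF h]; simp)
      show "finite {t. vector [y, 0] + t *\<^sub>R axis 2 1 \<in> S}"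
        using S 2 by simp
      show "((\<lambda>t. h (vector [y, t])) has_real_derivative d (vector [y, t])) (at t)"
        if "t \<notin> {t. vector [y, 0] + t *\<^sub>R axis 2 1 \<in> S}" for t
        using line[of "vector [y, 0]" t] that unfolding eq[symmetric] 2 by simp
      show "(\<lambda>t. d (vector [y, t])) \<in> borel_measurable borel"
        using measurable_compose[OF mv(2) d(1)] .
      show "\<bar>d (vector [y, t])\<bar> \<le> C" if "(t - b)\<^sup>2 + (y - a)\<^sup>2 < r\<^sup>2" for t
        using that r by (intro d) (simp add: mem_ball_plane a_def b_def del: mem_ball)
    qed fact
    have "ball_integral x0 r d = (LINT y|lborel. (if \<bar>y - a\<bar> \<le> r then G y else 0))"
      unfolding ball_integral_lborel[OF d(1)] fubini_plane(1)[OF int] chord ..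
    also have "\<dots> = (LINT y:{a - r..a + r}|lborel. G y)"
      unfolding set_lebesgue_integral_def
      by (intro Bochner_Integration.integral_cong) (auto simp: indicator_def abs_le_iff)
    also have "\<dots> = integral {a - r..a + r} G"
      by (intro set_integral_lborel_continuous G)
    finally show ?thesis
      using circle_flux_vertical[OF h r, of x0] 2 by (simp add: G_def[abs_def] a_def b_def)
  qed
qed

section \<open>Positive parts of quadratic forms\<close>

lemma
  assumes "(f has_derivative (\<lambda>v. D \<bullet> v)) (at x)"
  shows grad_eqI: "grad f x = D" and has_derivative_inner_differentiable: "f differentiable (at x)"
proof -
  show "f differentiable (at x)"
    using assms by (auto simp: differentiable_def)
  moreover have "(THE D. GDERIV f x :> D) = D"
  proof (rule the_equality)
    show "GDERIV f x :> D"
      using assms by (simp add: gderiv_def inner_commute)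
    fix D' assume "GDERIV f x :> D'"
    then have "(f has_derivative (\<lambda>v. v \<bullet> D')) (at x)"
      by (simp add: gderiv_def)
    from has_derivative_unique[OF this assms] show "D' = D"
      by (metis inner_commute vector_eq_rdot)
  qed
  ultimately show "grad f x = D"
    by (simp add: grad_def)
qed

lemma has_derivative_grad:
  fixes f :: "'a::euclidean_space \<Rightarrow> real"
  assumes "f differentiable (at x)"
  shows "(f has_derivative (\<lambda>v. grad f x \<bullet> v)) (at x)"
proof -
  obtain f' where f': "(f has_derivative f') (at x)"
    using assms by (auto simp: differentiable_def)
  have "f' = (\<lambda>v. (\<Sum>b\<in>Basis. f' b *\<^sub>R b) \<bullet> v)"
  proof
    fix v
    have "f' v = f' (\<Sum>b\<in>Basis. (v \<bullet> b) *\<^sub>R b)"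
      by (simp add: euclidean_representation)
    also have "\<dots> = (\<Sum>b\<in>Basis. (v \<bullet> b) * f' b)"
      using has_derivative_linear[OF f'] by (simp add: linear_sum linear_scale)
    also have "\<dots> = (\<Sum>b\<in>Basis. f' b *\<^sub>R b) \<bullet> v"
      by (simp add: inner_sum_left inner_commute[of v] mult.commute)
    finally show "f' v = (\<Sum>b\<in>Basis. f' b *\<^sub>R b) \<bullet> v" .
  qed
  then have "(f has_derivative (\<lambda>v. (\<Sum>b\<in>Basis. f' b *\<^sub>R b) \<bullet> v)) (at x)"
    using f' by simp
  with grad_eqI[OF this] show ?thesis by simp
qed

text \<open>At a point of differentiability this is Fermat's rule; elsewhere \<open>grad\<close> is
  0 by convention. It therefore covers the kinks of a nonnegative function on its zero set.\<close>

lemma grad_eq_0_at_min: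
  fixes f :: "'a::euclidean_space \<Rightarrow> real"
  assumes "\<And>y. f x \<le> f y"
  shows "grad f x = 0"
proof (cases "f differentiable (at x)")
  case True
  have "(\<lambda>v. grad f x \<bullet> v) = (\<lambda>v. 0)"
    by (rule differential_zero_maxmin[of x UNIV f]) (use assms has_derivative_grad[OF True] in auto)
  then show ?thesis
    by (metis inner_eq_zero_iff)
qed (simp add: grad_def)

text \<open>With z = x1 + i x2 and w = p + i q this is the real part of conj(w) z^2; replacing (p,
  q) by (-q, p) gives the imaginary part.\<close>

definition quad :: "real \<Rightarrow> real \<Rightarrow> real^2 \<Rightarrow> real" where
  "quad p q x = p * ((x $ 1)\<^sup>2 - (x $ 2)\<^sup>2) + 2 * q * x $ 1 * x $ 2"

text \<open>The symmetric trace-free matrix of \<open>quad p q\<close> applied to x, hence half its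
  gradient; in complex notation it is w conj(z).\<close>

definition qmat :: "real \<Rightarrow> real \<Rightarrow> real^2 \<Rightarrow> real^2" where
  "qmat p q x = vector [p * x $ 1 + q * x $ 2, q * x $ 1 - p * x $ 2]"

lemma qmat_simps [simp]:
  "qmat p q x $ 1 = p * x $ 1 + q * x $ 2" "qmat p q x $ 2 = q * x $ 1 - p * x $ 2"
  by (simp_all add: qmat_def)

lemma quad_eq_inner: "quad p q x = x \<bullet> qmat p q x"
  by (simp add: quad_def inner_plane power2_eq_square algebra_simps)

lemma bounded_linear_qmat [intro, simp]: "bounded_linear (qmat p q)"
proof -
  have "linear (qmat p q)"
    by (rule linearI) (simp_all add: plane_eq_iff algebra_simps)
  then show ?thesis by (rule linear_conv_bounded_linear[THEN iffD1])
qed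

lemma norm_qmat: "norm (qmat p q x) = sqrt (p\<^sup>2 + q\<^sup>2) * norm x"
proof -
  have "qmat p q x \<bullet> qmat p q x = (p\<^sup>2 + q\<^sup>2) * (x \<bullet> x)"
    by (simp add: inner_plane) algebra
  then show ?thesis
    by (simp add: norm_eq_sqrt_inner real_sqrt_mult)
qed

lemma has_derivative_quad:
  "(quad p q has_derivative (\<lambda>v. (2 *\<^sub>R qmat p q x) \<bullet> v)) (at x)"
proof -
  have "((\<lambda>x. x \<bullet> qmat p q x) has_derivative (\<lambda>v. x \<bullet> qmat p q v + v \<bullet> qmat p q x)) (at x)"
    by (rule has_derivative_inner[OF has_derivative_ident bounded_linear_imp_has_derivative]) simp
  then show ?thesis
    unfolding quad_eq_inner[abs_def]
    by (rule has_derivative_eq_rhs) (simp add: fun_eq_iff inner_plane algebra_simps)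
qed

lemma continuous_on_quad [continuous_intros]: "continuous_on S (quad p q)"
  by (meson continuous_at_imp_continuous_on has_derivative_continuous has_derivative_quad)

lemma continuous_on_qmat [continuous_intros]: "continuous_on S (qmat p q)"
  by (simp add: linear_continuous_on)

definition wedge :: "real \<Rightarrow> real \<Rightarrow> real \<Rightarrow> real \<Rightarrow> real^2 \<Rightarrow> real" where
  "wedge k d p q x = k * max 0 (\<bar>quad p q x\<bar> - d * (x \<bullet> x))"

text \<open>The gradient of the unclipped expression, given by the same formula at every point. This
  provides one-sided boundary values on the nodal lines, where the clipped function need not be
  differentiable.\<close>

definition wedge_grad :: "real \<Rightarrow> real \<Rightarrow> real \<Rightarrow> real \<Rightarrow> real^2 \<Rightarrow> real^2" where
  "wedge_grad k d p q x = (2 * k) *\<^sub>R (sgn (quad p q x) *\<^sub>R qmat p q x - d *\<^sub>R x)"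

lemma continuous_on_wedge [continuous_intros]: "continuous_on S (wedge k d p q)"
  unfolding wedge_def by (intro continuous_intros)

lemma wedge_nonneg: "0 \<le> k \<Longrightarrow> 0 \<le> wedge k d p q x"
  by (simp add: wedge_def)

lemma wedge_pos_iff: "0 < k \<Longrightarrow> 0 < wedge k d p q x \<longleftrightarrow> d * (x \<bullet> x) < \<bar>quad p q x\<bar>"
  by (auto simp: wedge_def zero_less_mult_iff)

lemma wedge_scale: "wedge k d p q (t *\<^sub>R x) = t\<^sup>2 * wedge k d p q x"
proof -
  have "quad p q (t *\<^sub>R x) = t\<^sup>2 * quad p q x"
    by (simp add: quad_def) algebra
  then have "\<bar>quad p q (t *\<^sub>R x)\<bar> - d * ((t *\<^sub>R x) \<bullet> (t *\<^sub>R x)) = t\<^sup>2 * (\<bar>quad p q x\<bar> - d * (x \<bullet> x))"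
    by (simp add: abs_mult power2_eq_square algebra_simps)
  moreover have "max 0 (t\<^sup>2 * y) = t\<^sup>2 * max 0 y" for y
    by (simp add: max_def mult_le_0_iff zero_le_mult_iff)
  ultimately show ?thesis
    by (simp only: wedge_def) simp
qed

text \<open>Take U where sigma \<open>quad\<close> exceeds d |y|^2, with sigma the sign of
  \<open>quad\<close> at x. As d is nonnegative, \<open>quad\<close> has the sign sigma throughout
  U. The absolute value thus disappears near x and \<open>wedge\<close> becomes a quadratic
  polynomial there.\<close>

lemma quad_sector_locally_constant_sign:
  assumes d: "0 \<le> d" and x: "d * (x \<bullet> x) < \<bar>quad p q x\<bar>"
  obtains U where "open U" "x \<in> U"
    "\<And>y. y \<in> U \<Longrightarrow> sgn (quad p q y) = sgn (quad p q x) \<and> d * (y \<bullet> y) < \<bar>quad p q y\<bar>"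
proof
  let ?U = "{y. d * (y \<bullet> y) < sgn (quad p q x) * quad p q y}"
  show "open ?U"
    by (intro open_Collect_less continuous_intros)
  show "x \<in> ?U"
    using x by (simp add: abs_sgn mult.commute)
  fix y assume "y \<in> ?U"
  then have *: "d * (y \<bullet> y) < sgn (quad p q x) * quad p q y" by simp
  moreover have "0 \<le> d * (y \<bullet> y)" using d by simp
  ultimately have "0 < sgn (quad p q x) * quad p q y" by linarith
  then have "sgn (quad p q y) = sgn (quad p q x)"
    by (auto simp: sgn_if zero_less_mult_iff split: if_splits)
  with * show "sgn (quad p q y) = sgn (quad p q x) \<and> d * (y \<bullet> y) < \<bar>quad p q y\<bar>"
    by (simp add: abs_sgn mult.commute)
qed

lemma has_derivative_wedge:
  assumes d: "0 \<le> d" and x: "d * (x \<bullet> x) < \<bar>quad p q x\<bar>"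
  shows "(wedge k d p q has_derivative (\<lambda>v. wedge_grad k d p q x \<bullet> v)) (at x)"
proof -
  obtain U where U: "open U" "x \<in> U"
    and sg: "\<And>y. y \<in> U \<Longrightarrow> sgn (quad p q y) = sgn (quad p q x) \<and> d * (y \<bullet> y) < \<bar>quad p q y\<bar>"
    using quad_sector_locally_constant_sign[OF assms] by blast
  have "((\<lambda>y. k * (sgn (quad p q x) * quad p q y - d * (y \<bullet> y))) has_derivative
      (\<lambda>v. wedge_grad k d p q x \<bullet> v)) (at x)"
    by (rule derivative_eq_intros has_derivative_quad refl)+
      (simp add: wedge_grad_def inner_simps algebra_simps inner_commute)
  then show ?thesis
  proof (rule has_derivative_transform_within_open[OF _ U])
    fix y assume "y \<in> U"
    from sg[OF this] show "k * (sgn (quad p q x) * quad p q y - d * (y \<bullet> y)) = wedge k d p q y"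
      by (auto simp: wedge_def abs_sgn mult.commute max_def)
  qed
qed

lemma has_derivative_wedge_zero:
  assumes x: "\<bar>quad p q x\<bar> < d * (x \<bullet> x)"
  shows "(wedge k d p q has_derivative (\<lambda>v. 0 \<bullet> v)) (at x)"
proof -
  let ?U = "{y. \<bar>quad p q y\<bar> < d * (y \<bullet> y)}"
  have U: "open ?U"
    by (intro open_Collect_less continuous_intros)
  show ?thesis
    by (rule has_derivative_transform_within_open[of "\<lambda>x. 0" _ _ _ ?U])
      (use x U in \<open>auto simp: wedge_def max_def\<close>)
qed

text \<open>This describes the total gradient at every point: where the wedge is not positive it
  attains its minimum 0, and \<open>grad_eq_0_at_min\<close> applies.\<close>

lemma grad_wedge:
  assumes "0 < k" "0 \<le> d"
  shows "grad (wedge k d p q) x = (if 0 < wedge k d p q x then wedge_grad k d p q x else 0)"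
proof (cases "0 < wedge k d p q x")
  case True
  then show ?thesis
    using assms grad_eqI[OF has_derivative_wedge[OF assms(2)]] by (simp add: wedge_pos_iff)
next
  case False
  then have "wedge k d p q x \<le> wedge k d p q y" for y
    using wedge_nonneg[of k d p q y] assms by simp
  then show ?thesis
    using False grad_eq_0_at_min by auto
qed

lemma has_derivative_wedge_grad:
  assumes d: "0 \<le> d" and x: "d * (x \<bullet> x) < \<bar>quad p q x\<bar>"
  shows "((\<lambda>y. wedge_grad k d p q y \<bullet> b) has_derivative
    (\<lambda>v. ((2 * k) *\<^sub>R (sgn (quad p q x) *\<^sub>R qmat p q b - d *\<^sub>R b)) \<bullet> v)) (at x)"
proof -
  obtain U where U: "open U" "x \<in> U"
    and sg: "\<And>y. y \<in> U \<Longrightarrow> sgn (quad p q y) = sgn (quad p q x) \<and> d * (y \<bullet> y) < \<bar>quad p q y\<bar>"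
    using quad_sector_locally_constant_sign[OF assms] by blast
  have 1: "((\<lambda>y. (2 * k) * (sgn (quad p q x) * (qmat p q y \<bullet> b) - d * (y \<bullet> b))) has_derivative
      (\<lambda>v. (2 * k) * (sgn (quad p q x) * (qmat p q v \<bullet> b) - d * (v \<bullet> b)))) (at x)"
    by (rule derivative_eq_intros bounded_linear_imp_has_derivative bounded_linear_qmat refl)+ auto
  have 2: "(2 * k) * (sgn (quad p q x) * (qmat p q v \<bullet> b) - d * (v \<bullet> b))
      = ((2 * k) *\<^sub>R (sgn (quad p q x) *\<^sub>R qmat p q b - d *\<^sub>R b)) \<bullet> v" for v
    by (simp add: inner_plane algebra_simps)
  show ?thesis
    using 1 unfolding 2
    by (rule has_derivative_transform_within_open[OF _ U])
      (use sg in \<open>simp add: wedge_grad_def inner_plane algebra_simps\<close>)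
qed

lemma has_derivative_grad_wedge:
  assumes k: "0 < k" and d: "0 \<le> d" and x: "0 < wedge k d p q x"
  shows "((\<lambda>y. grad (wedge k d p q) y \<bullet> b) has_derivative
    (\<lambda>v. ((2 * k) *\<^sub>R (sgn (quad p q x) *\<^sub>R qmat p q b - d *\<^sub>R b)) \<bullet> v)) (at x)"
proof -
  have "open {y. 0 < wedge k d p q y}"
    by (intro open_Collect_less continuous_intros)
  from has_derivative_transform_within_open[OF has_derivative_wedge_grad[OF d] this] show ?thesis
    using x by (simp add: wedge_pos_iff[OF k] grad_wedge[OF k d])
qed

lemma cont_diff_wedge:
  assumes k: "0 < k" and d: "0 \<le> d" and S: "S \<subseteq> {x. 0 < wedge k d p q x}"
  shows "cont_diff_on 2 S (wedge k d p q)"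
proof -
  have q: "quad p q x \<noteq> 0" if "x \<in> S" for x
  proof -
    have "0 \<le> d * (x \<bullet> x)" using d by simp
    with that S wedge_pos_iff[OF k] show ?thesis by force
  qed
  have "continuous_on S (\<lambda>x. grad (\<lambda>y. grad (wedge k d p q) y \<bullet> b) x \<bullet> b')" for b b'
  proof (rule continuous_on_cong[THEN iffD1, OF refl])
    show "continuous_on S (\<lambda>x. ((2 * k) *\<^sub>R (sgn (quad p q x) *\<^sub>R qmat p q b - d *\<^sub>R b)) \<bullet> b')"
      using q by (intro continuous_intros) auto
  qed (use S grad_eqI[OF has_derivative_grad_wedge[OF k d]] in auto)
  moreover have "wedge k d p q differentiable (at x)" if "x \<in> S" for x
    using that S has_derivative_inner_differentiable[OF has_derivative_wedge[OF d]]
    by (auto simp: wedge_pos_iff[OF k])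
  moreover have "(\<lambda>y. grad (wedge k d p q) y \<bullet> b) differentiable (at x)" if "x \<in> S" for x b
    using that S has_derivative_inner_differentiable[OF has_derivative_grad_wedge[OF k d]] by auto
  ultimately show ?thesis
    by (simp add: numeral_2_eq_2)
qed

text \<open>\<open>quad\<close> is harmonic because its matrix is trace-free, so only - k d |x|^2
  contributes, and |x|^2 has Laplacian 4 in the plane.\<close>

lemma laplacian_wedge:
  assumes k: "0 < k" and d: "0 \<le> d" and x: "0 < wedge k d p q x"
  shows "laplacian (wedge k d p q) x = - 4 * k * d"
proof -
  have "axis 1 (1::real) \<noteq> (axis 2 1 :: real^2)"
    by (simp add: axis_eq_axis)
  then show ?thesis
    by (simp add: laplacian_def grad_eqI[OF has_derivative_grad_wedge[OF k d x]] Basis_real2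
        inner_simps inner_axis) (simp add: axis_def algebra_simps)
qed

text \<open>The difference of a quadratic form at x and y is its bilinear form at x - y and x + y,
  and |x + y| is at most 2 R. Absolute value and positive part do not enlarge differences.\<close>

lemma wedge_lipschitz:
  assumes k: "0 < k" and d: "0 \<le> d" and pq: "p\<^sup>2 + q\<^sup>2 = 1"
    and x: "norm x \<le> R" and y: "norm y \<le> R"
  shows "\<bar>wedge k d p q x - wedge k d p q y\<bar> \<le> k * (1 + d) * (2 * R) * norm (x - y)"
proof -
  have xy: "norm (x + y) \<le> 2 * R"
    using norm_triangle_ineq[of x y] x y by linarith
  have "quad p q x - quad p q y = (x - y) \<bullet> qmat p q (x + y)"
    by (simp add: quad_eq_inner inner_plane algebra_simps)
  then have 1: "\<bar>quad p q x - quad p q y\<bar> \<le> norm (x - y) * (2 * R)"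
    using Cauchy_Schwarz_ineq2[of "x - y" "qmat p q (x + y)"] mult_left_mono[OF xy, of "norm (x - y)"]
    by (simp add: norm_qmat pq)
  have "x \<bullet> x - y \<bullet> y = (x - y) \<bullet> (x + y)"
    by (simp add: inner_simps inner_commute)
  then have 2: "\<bar>x \<bullet> x - y \<bullet> y\<bar> \<le> norm (x - y) * (2 * R)"
    using Cauchy_Schwarz_ineq2[of "x - y" "x + y"] mult_left_mono[OF xy, of "norm (x - y)"] by simp
  let ?X = "\<bar>quad p q x\<bar> - d * (x \<bullet> x)" and ?Y = "\<bar>quad p q y\<bar> - d * (y \<bullet> y)"
  have "\<bar>d * (x \<bullet> x) - d * (y \<bullet> y)\<bar> \<le> d * (norm (x - y) * (2 * R))"
    using mult_left_mono[OF 2 d] d by (simp add: right_diff_distrib[symmetric] abs_mult)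
  then have "\<bar>max 0 ?X - max 0 ?Y\<bar> \<le> norm (x - y) * (2 * R) + d * (norm (x - y) * (2 * R))"
    using 1 by (simp add: max_def abs_le_iff) linarith
  then have "k * \<bar>max 0 ?X - max 0 ?Y\<bar> \<le> k * (norm (x - y) * (2 * R) + d * (norm (x - y) * (2 * R)))"
    using k by simp
  moreover have "\<bar>wedge k d p q x - wedge k d p q y\<bar> = k * \<bar>max 0 ?X - max 0 ?Y\<bar>"
    using k by (simp add: wedge_def right_diff_distrib[symmetric] abs_mult)
  ultimately show ?thesis
    by (simp add: algebra_simps)
qed

text \<open>Away from the origin \<open>quad\<close> is nonzero on this set because d > 0, so its
  sign is locally constant. At the origin the factor \<open>qmat\<close> tends to 0 and absorbs the
  jumps of the sign.\<close>

lemma continuous_on_sgn_qmat: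
  assumes d: "0 < d"
  shows "continuous_on {x. d * (x \<bullet> x) \<le> \<bar>quad p q x\<bar>} (\<lambda>x. sgn (quad p q x) *\<^sub>R qmat p q x)"
    (is "continuous_on ?S ?f")
proof (rule continuous_at_imp_continuous_on, rule ballI)
  fix x assume "x \<in> ?S"
  show "isCont ?f x"
  proof (cases "x = 0")
    case False
    then have "quad p q x \<noteq> 0"
      using \<open>x \<in> ?S\<close> mult_pos_pos[OF d, of "x \<bullet> x"] by (auto simp del: mult_pos_pos)
    moreover have "isCont (quad p q) x" "isCont (qmat p q) x"
      using continuous_on_quad[of UNIV] continuous_on_qmat[of UNIV]
      by (simp_all add: continuous_on_eq_continuous_at)
    ultimately show ?thesis
      by (intro continuous_intros) auto
  next
    case True
    have "((\<lambda>y. sgn (quad p q y) *\<^sub>R qmat p q y) \<longlongrightarrow> 0) (at 0)"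
    proof (rule Lim_null_comparison)
      show "\<forall>\<^sub>F y in at 0. norm (sgn (quad p q y) *\<^sub>R qmat p q y) \<le> sqrt (p\<^sup>2 + q\<^sup>2) * norm y"
        by (auto simp: norm_qmat abs_sgn_eq)
      show "((\<lambda>y. sqrt (p\<^sup>2 + q\<^sup>2) * norm y) \<longlongrightarrow> 0) (at 0)"
        by (intro tendsto_mult_right_zero tendsto_norm_zero tendsto_ident_at)
    qed
    then show ?thesis
      using True by (simp add: isCont_def quad_def)
  qed
qed

section \<open>Pohozaev identity and weak derivatives of piecewise smooth functions\<close>

text \<open>Existential bounds compose as introduction rules, so the boundedness of polynomial
  expressions follows from their syntax without naming the constants.\<close>

lemma exists_bound_const: "\<exists>C. \<forall>x\<in>S. \<bar>c\<bar> \<le> (C::real)"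
  by auto

lemma exists_bound_add:
  fixes f g :: "'a \<Rightarrow> real"
  assumes "\<exists>C. \<forall>x\<in>S. \<bar>f x\<bar> \<le> C" "\<exists>C. \<forall>x\<in>S. \<bar>g x\<bar> \<le> C"
  shows "\<exists>C. \<forall>x\<in>S. \<bar>f x + g x\<bar> \<le> C"
proof -
  obtain C D where "\<forall>x\<in>S. \<bar>f x\<bar> \<le> C" "\<forall>x\<in>S. \<bar>g x\<bar> \<le> D"
    using assms by blast
  then show ?thesis
    by (intro exI[of _ "C + D"] ballI) (metis abs_triangle_ineq add_mono order_trans)
qed

lemma exists_bound_minus:
  fixes f :: "'a \<Rightarrow> real"
  assumes "\<exists>C. \<forall>x\<in>S. \<bar>f x\<bar> \<le> C"
  shows "\<exists>C. \<forall>x\<in>S. \<bar>- f x\<bar> \<le> C"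
  using assms by simp

lemma exists_bound_diff:
  fixes f g :: "'a \<Rightarrow> real"
  assumes "\<exists>C. \<forall>x\<in>S. \<bar>f x\<bar> \<le> C" "\<exists>C. \<forall>x\<in>S. \<bar>g x\<bar> \<le> C"
  shows "\<exists>C. \<forall>x\<in>S. \<bar>f x - g x\<bar> \<le> C"
  using exists_bound_add[OF assms(1) exists_bound_minus[OF assms(2)]] by simp

lemma exists_bound_mult:
  fixes f g :: "'a \<Rightarrow> real"
  assumes "\<exists>C. \<forall>x\<in>S. \<bar>f x\<bar> \<le> C" "\<exists>C. \<forall>x\<in>S. \<bar>g x\<bar> \<le> C"
  shows "\<exists>C. \<forall>x\<in>S. \<bar>f x * g x\<bar> \<le> C"
proof -
  obtain C D where "\<forall>x\<in>S. \<bar>f x\<bar> \<le> C" "\<forall>x\<in>S. \<bar>g x\<bar> \<le> D"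
    using assms by blast
  then show ?thesis
    by (intro exI[of _ "C * D"] ballI) (auto simp: abs_mult intro!: mult_mono order_trans[OF abs_ge_zero])
qed

lemma exists_bound_continuous:
  fixes f :: "'a::heine_borel \<Rightarrow> real"
  assumes "continuous_on UNIV f"
  shows "\<exists>C. \<forall>x\<in>ball a r. \<bar>f x\<bar> \<le> C"
proof -
  have "bounded (f ` cball a r)"
    by (intro compact_imp_bounded compact_continuous_image continuous_on_subset[OF assms]) auto
  then obtain C where "\<forall>y\<in>f ` cball a r. norm y \<le> C"
    by (auto simp: bounded_iff)
  then show ?thesis
    by (intro exI[of _ C]) auto
qed

lemmas exists_bound_intros =
  exists_bound_const exists_bound_add exists_bound_minus exists_bound_diff exists_bound_mult

section \<open>Linearity and congruence of disc and circle integrals\<close>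

lemma ball_integral_add:
  assumes "f \<in> borel_measurable borel" "g \<in> borel_measurable borel"
    and "\<exists>C. \<forall>x\<in>ball x0 r. \<bar>f x\<bar> \<le> C" "\<exists>C. \<forall>x\<in>ball x0 r. \<bar>g x\<bar> \<le> C"
  shows "ball_integral x0 r (\<lambda>x. f x + g x) = ball_integral x0 r f + ball_integral x0 r g"
proof -
  have "integrable lborel (\<lambda>x. indicator (ball x0 r) x * f x)"
    "integrable lborel (\<lambda>x. indicator (ball x0 r) x * g x)"
    using assms integrable_ball_bounded by blast+
  then show ?thesis
    using assms by (simp add: ball_integral_lborel borel_measurable_add distrib_left)
qed

lemma circle_integral_add:
  assumes "continuous_on UNIV f" "continuous_on UNIV g"
  shows "circle_integral x0 r (\<lambda>x. f x + g x) = circle_integral x0 r f + circle_integral x0 r g"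
proof -
  have "(\<lambda>\<theta>. f (x0 + r *\<^sub>R vector [cos \<theta>, sin \<theta>]) * r) integrable_on {0..2*pi}"
    if "continuous_on UNIV f" for f :: "real^2 \<Rightarrow> real"
    by (intro integrable_continuous_real continuous_intros continuous_on_compose2[OF that]) auto
  then show ?thesis
    using assms
    by (simp add: circle_integral_eq_integral continuous_on_add distrib_right
        Henstock_Kurzweil_Integration.integral_add)
qed

lemma circle_integral_cmult:
  "circle_integral x0 r (\<lambda>x. a * f x) = a * circle_integral x0 r f"
  unfolding circle_integral_def set_lebesgue_integral_def
  by (simp add: mult.assoc mult.left_commute[of a] flip: Bochner_Integration.integral_mult_right_zero)

lemma circle_integral_cong_on:
  assumes "\<And>\<theta>. \<theta> \<in> {0..2*pi} \<Longrightarrow> f (x0 + r *\<^sub>R vector [cos \<theta>, sin \<theta>]) = g (x0 + r *\<^sub>R vector [cos \<theta>, sin \<theta>])"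
  shows "circle_integral x0 r f = circle_integral x0 r g"
  unfolding circle_integral_def using assms
  by (intro set_lebesgue_integral_cong) auto

text \<open>A countable set of angles is null. With \<open>S\<close> the nodal set, the integrand
  may be rewritten by formulas valid only off the nodal lines.\<close>

lemma circle_integral_cong_countable:
  assumes X: "countable {\<theta>. x0 + r *\<^sub>R vector [cos \<theta>, sin \<theta>] \<in> S}"
    and "\<And>x. x \<notin> S \<Longrightarrow> f x = g x"
  shows "circle_integral x0 r f = circle_integral x0 r g"
  unfolding circle_integral_def set_lebesgue_integral_def
  by (rule integral_discrete_difference[OF X]) (use assms(2) in auto)

text \<open>If \<open>W = \<nabla>v\<close>, \<open>\<nabla>G = g W\<close> and \<open>\<Delta>v = - g\<close>, then the field
  \<open>\<bar>W\<bar>\<^sup>2 X - 2 (X \<bullet> W) W - 2 G X\<close>, \<open>X = x - x0\<close>, has divergence \<open>- 4 G\<close>. The entries of the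
  Hessian of \<open>v\<close> are \<open>w11\<close>, \<open>w12\<close>, \<open>w22\<close>.\<close>

lemma pohozaev_flux_identity:
  fixes W :: "real^2 \<Rightarrow> real^2" and G g w11 w12 w22 :: "real^2 \<Rightarrow> real"
  assumes W: "continuous_on UNIV W" and G: "continuous_on UNIV G"
    and W1: "\<And>x. x \<notin> S \<Longrightarrow> ((\<lambda>y. W y $ 1) has_derivative (\<lambda>v. w11 x * v $ 1 + w12 x * v $ 2)) (at x)"
    and W2: "\<And>x. x \<notin> S \<Longrightarrow> ((\<lambda>y. W y $ 2) has_derivative (\<lambda>v. w12 x * v $ 1 + w22 x * v $ 2)) (at x)"
    and G': "\<And>x. x \<notin> S \<Longrightarrow> (G has_derivative (\<lambda>v. g x * (W x \<bullet> v))) (at x)"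
    and tr: "\<And>x. w11 x + w22 x = - g x"
    and w [measurable]: "w11 \<in> borel_measurable borel" "w12 \<in> borel_measurable borel"
      "w22 \<in> borel_measurable borel" "g \<in> borel_measurable borel"
    and bd: "\<exists>C. \<forall>x\<in>ball x0 r. \<bar>w11 x\<bar> \<le> C" "\<exists>C. \<forall>x\<in>ball x0 r. \<bar>w12 x\<bar> \<le> C"
      "\<exists>C. \<forall>x\<in>ball x0 r. \<bar>w22 x\<bar> \<le> C" "\<exists>C. \<forall>x\<in>ball x0 r. \<bar>g x\<bar> \<le> C"
    and S: "\<And>x i. finite {t. x + t *\<^sub>R axis i 1 \<in> S}"
    and r: "0 < r"
  shows "r * circle_integral x0 r (\<lambda>x. W x \<bullet> W x) =
    2 * r * circle_integral x0 r (\<lambda>x. (W x \<bullet> ((x - x0) /\<^sub>R r))\<^sup>2)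
    + 2 * r * circle_integral x0 r G - 4 * ball_integral x0 r G"
proof -
  define X1 X2 U V where "X1 x = x $ 1 - x0 $ 1" and "X2 x = x $ 2 - x0 $ 2"
    and "U x = W x $ 1" and "V x = W x $ 2" for x
  note defs = X1_def X2_def U_def V_def
  have c: "continuous_on UNIV X1" "continuous_on UNIV X2" "continuous_on UNIV U" "continuous_on UNIV V"
    unfolding defs using W by (auto intro!: continuous_intros continuous_on_component)
  note [measurable] = c[THEN borel_measurable_continuous_onI] G[THEN borel_measurable_continuous_onI]
  note bounds = exists_bound_intros bd c[THEN exists_bound_continuous] G[THEN exists_bound_continuous]
  have dX: "(X1 has_derivative (\<lambda>v. v $ 1)) (at x)" "(X2 has_derivative (\<lambda>v. v $ 2)) (at x)" for x
    unfolding defs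
    by (auto intro!: derivative_eq_intros bounded_linear_imp_has_derivative bounded_linear_vec_nth)
  \<comment> \<open>\<open>P\<close> and \<open>Q\<close> are the two components of the field named
    above, written with W = (U, V) and X = (X1, X2).\<close>
  define P where "P x = ((V x)\<^sup>2 - (U x)\<^sup>2) * X1 x - 2 * X2 x * U x * V x - 2 * G x * X1 x" for x
  define Q where "Q x = ((U x)\<^sup>2 - (V x)\<^sup>2) * X2 x - 2 * X1 x * U x * V x - 2 * G x * X2 x" for x
  \<comment> \<open>Off \<open>S\<close>, \<open>p\<close> and \<open>q\<close> are the derivatives
    of \<open>P\<close> in the first and of \<open>Q\<close> in the second direction. Squares are
    written as products to match \<open>exists_bound_mult\<close>.\<close>
  define p where "p x = (2 * V x * w12 x - 2 * U x * w11 x) * X1 x + (V x * V x - U x * U x)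
      - 2 * X2 x * (w11 x * V x + U x * w12 x) - 2 * g x * U x * X1 x - 2 * G x" for x
  define q where "q x = (2 * U x * w12 x - 2 * V x * w22 x) * X2 x + (U x * U x - V x * V x)
      - 2 * X1 x * (w12 x * V x + U x * w22 x) - 2 * g x * V x * X2 x - 2 * G x" for x
  \<comment> \<open>The mixed terms cancel, and the remaining ones contain the factor w11 + w22 + g
    = 0, except for - 2 G from each component.\<close>
  have pq: "p x + q x = - 4 * G x" for x
    using tr[of x] unfolding p_def q_def by algebra
  have cP: "continuous_on UNIV P" "continuous_on UNIV Q"
    unfolding P_def Q_def by (intro continuous_intros c G)+
  have mp: "p \<in> borel_measurable borel" "q \<in> borel_measurable borel"
    unfolding p_def[abs_def] q_def[abs_def] by measurable
  have bp: "\<exists>C. \<forall>x\<in>ball x0 r. \<bar>p x\<bar> \<le> C" "\<exists>C. \<forall>x\<in>ball x0 r. \<bar>q x\<bar> \<le> C"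
    unfolding p_def[abs_def] q_def[abs_def] by (intro bounds)+
  note dUV = W1[folded U_def] W2[folded V_def]
  have ax: "axis (1::2) 1 $ 1 = (1::real)" "axis (1::2) 1 $ 2 = (0::real)"
    "axis (2::2) 1 $ 1 = (0::real)" "axis (2::2) 1 $ 2 = (1::real)"
    by (simp_all add: axis_def)
  obtain Cp Cq where Cp: "\<And>x. x \<in> ball x0 r \<Longrightarrow> \<bar>p x\<bar> \<le> Cp" and Cq: "\<And>x. x \<in> ball x0 r \<Longrightarrow> \<bar>q x\<bar> \<le> Cq"
    using bp by blast
  have 1: "ball_integral x0 r p = circle_integral x0 r (\<lambda>x. P x * ((x - x0) $ 1 / r))"
  proof (rule divergence_disc[OF cP(1) _ S mp(1) Cp _ r])
    fix x assume x: "x \<notin> S"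
    show "(P has_derivative (\<lambda>v. (2 * V x * (w12 x * v $ 1 + w22 x * v $ 2)
        - 2 * U x * (w11 x * v $ 1 + w12 x * v $ 2)) * X1 x + ((V x)\<^sup>2 - (U x)\<^sup>2) * v $ 1
        - 2 * (v $ 2 * U x * V x + X2 x * (w11 x * v $ 1 + w12 x * v $ 2) * V x
          + X2 x * U x * (w12 x * v $ 1 + w22 x * v $ 2))
        - 2 * (g x * (W x \<bullet> v) * X1 x + G x * v $ 1))) (at x)"
      unfolding P_def[abs_def]
      by (rule derivative_eq_intros dX dUV[OF x] G'[OF x] refl)+
        (simp add: fun_eq_iff algebra_simps)
    show "p x = (2 * V x * (w12 x * axis (1::2) 1 $ 1 + w22 x * axis (1::2) 1 $ 2)
        - 2 * U x * (w11 x * axis (1::2) 1 $ 1 + w12 x * axis (1::2) 1 $ 2)) * X1 x + ((V x)\<^sup>2 - (U x)\<^sup>2) * axis (1::2) 1 $ 1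
        - 2 * (axis (1::2) 1 $ 2 * U x * V x + X2 x * (w11 x * axis (1::2) 1 $ 1 + w12 x * axis (1::2) 1 $ 2) * V x
          + X2 x * U x * (w12 x * axis (1::2) 1 $ 1 + w22 x * axis (1::2) 1 $ 2))
        - 2 * (g x * (W x \<bullet> axis (1::2) 1) * X1 x + G x * axis (1::2) 1 $ 1)"
      unfolding p_def inner_plane ax U_def[symmetric] V_def[symmetric] by algebra
  qed auto
  have 2: "ball_integral x0 r q = circle_integral x0 r (\<lambda>x. Q x * ((x - x0) $ 2 / r))"
  proof (rule divergence_disc[OF cP(2) _ S mp(2) Cq _ r])
    fix x assume x: "x \<notin> S"
    show "(Q has_derivative (\<lambda>v. (2 * U x * (w11 x * v $ 1 + w12 x * v $ 2)
        - 2 * V x * (w12 x * v $ 1 + w22 x * v $ 2)) * X2 x + ((U x)\<^sup>2 - (V x)\<^sup>2) * v $ 2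
        - 2 * (v $ 1 * U x * V x + X1 x * (w11 x * v $ 1 + w12 x * v $ 2) * V x
          + X1 x * U x * (w12 x * v $ 1 + w22 x * v $ 2))
        - 2 * (g x * (W x \<bullet> v) * X2 x + G x * v $ 2))) (at x)"
      unfolding Q_def[abs_def]
      by (rule derivative_eq_intros dX dUV[OF x] G'[OF x] refl)+
        (simp add: fun_eq_iff algebra_simps)
    show "q x = (2 * U x * (w11 x * axis (2::2) 1 $ 1 + w12 x * axis (2::2) 1 $ 2)
        - 2 * V x * (w12 x * axis (2::2) 1 $ 1 + w22 x * axis (2::2) 1 $ 2)) * X2 x + ((U x)\<^sup>2 - (V x)\<^sup>2) * axis (2::2) 1 $ 2
        - 2 * (axis (2::2) 1 $ 1 * U x * V x + X1 x * (w11 x * axis (2::2) 1 $ 1 + w12 x * axis (2::2) 1 $ 2) * V x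
          + X1 x * U x * (w12 x * axis (2::2) 1 $ 1 + w22 x * axis (2::2) 1 $ 2))
        - 2 * (g x * (W x \<bullet> axis (2::2) 1) * X2 x + G x * axis (2::2) 1 $ 2)"
      unfolding q_def inner_plane ax U_def[symmetric] V_def[symmetric] by algebra
  qed auto
  have "circle_integral x0 r (\<lambda>x. P x * ((x - x0) $ 1 / r) + Q x * ((x - x0) $ 2 / r))
      = ball_integral x0 r (\<lambda>x. p x + q x)"
    using 1 2 ball_integral_add[OF mp bp] cP r
    by (subst circle_integral_add) (auto intro!: continuous_intros continuous_on_component)
  also have "\<dots> = - 4 * ball_integral x0 r G"
    unfolding pq by (simp add: ball_integral_def set_lebesgue_integral_def mult.left_commute)
  \<comment> \<open>On the circle X is r times the unit normal, so the normal component of the field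
    is r |W|^2 - 2 r (W . normal)^2 - 2 r G.\<close>
  also have "circle_integral x0 r (\<lambda>x. P x * ((x - x0) $ 1 / r) + Q x * ((x - x0) $ 2 / r))
      = circle_integral x0 r (\<lambda>x. r * (W x \<bullet> W x)
          + ((- 2 * r) * (W x \<bullet> ((x - x0) /\<^sub>R r))\<^sup>2 + (- 2 * r) * G x))"
  proof (rule circle_integral_cong_on)
    fix \<theta> :: real
    let ?x = "x0 + r *\<^sub>R vector [cos \<theta>, sin \<theta>]"
    have *: "X1 ?x = r * cos \<theta>" "X2 ?x = r * sin \<theta>" "(?x - x0) $ 1 / r = cos \<theta>" "(?x - x0) $ 2 / r = sin \<theta>"
      "W ?x \<bullet> W ?x = U ?x * U ?x + V ?x * V ?x"
      "W ?x \<bullet> ((?x - x0) /\<^sub>R r) = U ?x * cos \<theta> + V ?x * sin \<theta>"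
      using r by (simp_all add: defs inner_plane)
    have cs: "(cos \<theta>)\<^sup>2 + (sin \<theta>)\<^sup>2 = 1" by simp
    show "P ?x * ((?x - x0) $ 1 / r) + Q ?x * ((?x - x0) $ 2 / r)
        = r * (W ?x \<bullet> W ?x) + ((- 2 * r) * (W ?x \<bullet> ((?x - x0) /\<^sub>R r))\<^sup>2 + (- 2 * r) * G ?x)"
      unfolding P_def Q_def * using cs by algebra
  qed
  also have "\<dots> = r * circle_integral x0 r (\<lambda>x. W x \<bullet> W x)
      + ((- 2 * r) * circle_integral x0 r (\<lambda>x. (W x \<bullet> ((x - x0) /\<^sub>R r))\<^sup>2)
      + (- 2 * r) * circle_integral x0 r G)"
    by (simp only: circle_integral_cmult[symmetric], subst circle_integral_add[symmetric],
       (intro continuous_intros W G)+, subst circle_integral_add[symmetric])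
      (intro continuous_intros W G refl)+
  finally show ?thesis by simp
qed

text \<open>Apply \<open>divergence_disc\<close> to the product of f with the test function on a
  disc containing the support. The circle integral vanishes, leaving integration by parts;
  continuity of f prevents any contribution from \<open>S\<close>.\<close>

lemma weak_partial_piecewise:
  fixes f :: "real^2 \<Rightarrow> real" and F :: "real^2 \<Rightarrow> real^2"
  assumes f: "continuous_on UNIV f"
    and f': "\<And>x. x \<notin> S \<Longrightarrow> (f has_derivative (\<lambda>v. F x \<bullet> v)) (at x)"
    and S: "\<And>x. finite {t. x + t *\<^sub>R axis i 1 \<in> S}"
    and F [measurable]: "(\<lambda>x. F x $ i) \<in> borel_measurable borel"
    and bd: "\<And>r. \<exists>C. \<forall>x\<in>ball 0 r. \<bar>F x $ i\<bar> \<le> C"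
  shows "weak_partial f (axis i 1) (\<lambda>x. F x $ i)"
  unfolding weak_partial_def
proof (intro allI impI)
  fix \<phi> :: "real^2 \<Rightarrow> real" assume "test_function \<phi>"
  then obtain K where K: "compact K" "\<And>x. x \<notin> K \<Longrightarrow> \<phi> x = 0"
    and "\<forall>n. cont_diff_on n UNIV \<phi>"
    unfolding test_function_def by blast
  then have "cont_diff_on 0 UNIV \<phi>" "cont_diff_on (Suc 0) UNIV \<phi>"
    by blast+
  then have diff: "\<And>x. \<phi> differentiable (at x)" and c: "continuous_on UNIV \<phi>"
    and "\<And>b. b \<in> Basis \<Longrightarrow> continuous_on UNIV (\<lambda>x. grad \<phi> x \<bullet> b)"
    by auto
  then have c': "continuous_on UNIV (\<lambda>x. grad \<phi> x \<bullet> axis i 1)"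
    by (simp add: axis_in_Basis_iff)
  obtain R where R: "0 < R" "K \<subseteq> ball 0 R"
    using compact_imp_bounded[OF K(1)] bounded_subset_ballD[of _ 0] by blast
  have out: "\<phi> x = 0 \<and> grad \<phi> x \<bullet> axis i 1 = 0" if "x \<notin> ball 0 R" for x
  proof -
    have "open (- K)" "x \<in> - K"
      using K(1) R(2) that by (auto intro: compact_imp_closed)
    then have "(\<phi> has_derivative (\<lambda>v. 0 \<bullet> v)) (at x)"
      by (intro has_derivative_transform_within_open[of "\<lambda>x. 0" _ _ _ "- K" \<phi>]) (auto simp: K(2))
    from grad_eqI[OF this] K(2) \<open>x \<in> - K\<close> show ?thesis by simp
  qed
  note [measurable] = c[THEN borel_measurable_continuous_onI] c'[THEN borel_measurable_continuous_onI]
    f[THEN borel_measurable_continuous_onI]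
  note bounds = exists_bound_intros bd c[THEN exists_bound_continuous] f[THEN exists_bound_continuous]
    c'[THEN exists_bound_continuous]
  let ?a = "\<lambda>x. f x * (grad \<phi> x \<bullet> axis i 1)" and ?b = "\<lambda>x. F x $ i * \<phi> x"
  have m: "?a \<in> borel_measurable borel" "?b \<in> borel_measurable borel"
    by measurable
  have b: "\<exists>C. \<forall>x\<in>ball 0 R. \<bar>?a x\<bar> \<le> C" "\<exists>C. \<forall>x\<in>ball 0 R. \<bar>?b x\<bar> \<le> C"
    by (intro bounds)+
  have eq: "ball_integral 0 R g = (LINT x|lebesgue. g x)"
    if "\<And>x. x \<notin> ball 0 R \<Longrightarrow> g x = 0" for g :: "real^2 \<Rightarrow> real"
    unfolding ball_integral_def set_lebesgue_integral_def using that
    by (intro Bochner_Integration.integral_cong refl) (auto simp: indicator_def)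
  obtain C where C: "\<And>x. x \<in> ball 0 R \<Longrightarrow> \<bar>?a x + ?b x\<bar> \<le> C"
    using exists_bound_add[OF b] by blast
  have "ball_integral 0 R (\<lambda>x. ?a x + ?b x)
      = circle_integral 0 R (\<lambda>x. (f x * \<phi> x) * ((x - 0) $ i / R))"
  proof (rule divergence_disc[OF _ _ S _ C _ R(1)])
    show "continuous_on UNIV (\<lambda>x. f x * \<phi> x)"
      by (intro continuous_intros f c)
    show "((\<lambda>x. f x * \<phi> x) has_derivative (\<lambda>v. f x * (grad \<phi> x \<bullet> v) + (F x \<bullet> v) * \<phi> x)) (at x)"
      if "x \<notin> S" for x
      by (rule has_derivative_mult[OF f'[OF that] has_derivative_grad[OF diff]])
  qed (use m in \<open>auto simp: inner_axis\<close>)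
  also have "\<dots> = circle_integral 0 R (\<lambda>x. 0)"
  proof (rule circle_integral_cong_on)
    fix \<theta> :: real
    have "norm (vector [cos \<theta>, sin \<theta>] :: real^2) = 1"
      by (simp add: norm_eq_sqrt_inner inner_plane flip: power2_eq_square)
    then show "f (0 + R *\<^sub>R vector [cos \<theta>, sin \<theta>]) * \<phi> (0 + R *\<^sub>R vector [cos \<theta>, sin \<theta>])
        * ((0 + R *\<^sub>R vector [cos \<theta>, sin \<theta>] - 0) $ i / R) = 0"
      using out[of "R *\<^sub>R vector [cos \<theta>, sin \<theta>]"] R(1) by simp
  qed
  also have "\<dots> = 0"
    by (simp add: circle_integral_def)
  finally have "ball_integral 0 R ?a + ball_integral 0 R ?b = 0"
    using ball_integral_add[OF m b] by simp
  then show "(LINT x|lebesgue. f x * (grad \<phi> x \<bullet> axis i 1)) = - (LINT x|lebesgue. F x $ i * \<phi> x)"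
    by (subst (asm) (1 2) eq) (use out in auto)
qed

lemma L2_loc_I:
  fixes f :: "real^2 \<Rightarrow> real"
  assumes f: "f \<in> borel_measurable borel" and bd: "\<And>r. \<exists>C. \<forall>x\<in>ball 0 r. \<bar>f x\<bar> \<le> C"
  shows "f \<in> L2_loc"
proof -
  have "set_integrable lebesgue K (\<lambda>x. (f x)\<^sup>2)" if K0: "compact K" for K
  proof -
    obtain R where R: "K \<subseteq> ball 0 R"
      using compact_imp_bounded[OF K0] bounded_subset_ballD[of _ 0] by blast
    obtain C where C: "\<forall>x\<in>ball 0 R. \<bar>f x * f x\<bar> \<le> C"
      using exists_bound_mult[OF bd bd] by blast
    have K: "K \<in> sets borel"
      using that by (simp add: borel_compact)
    have m: "(\<lambda>x. (f x)\<^sup>2) \<in> borel_measurable borel"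
      using f by measurable
    have mi: "(\<lambda>x. indicat_real K x *\<^sub>R (f x)\<^sup>2) \<in> borel_measurable borel"
      using K m by (intro borel_measurable_scaleR borel_measurable_indicator)
    have "integrable lborel (\<lambda>x. indicat_real K x *\<^sub>R (f x)\<^sup>2)"
    proof (rule integrableI_bounded_set[where A=K and B=C])
      show "emeasure lborel K < \<infinity>"
        using emeasure_bounded_finite[OF compact_imp_bounded[OF that]] by (simp add: infinity_ennreal_def)
    qed (use K mi C R in \<open>auto simp: indicator_def power2_eq_square\<close>)
    then show ?thesis
      unfolding set_integrable_def using mi by (simp add: integrable_completion)
  qed
  moreover have "f \<in> borel_measurable lebesgue"
    using f by (simp add: measurable_completion)
  ultimately show ?thesis
    by (simp add: L2_loc_def)
qed

lemma local_equationI: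
  assumes D: "\<And>x. (f has_derivative (\<lambda>v. D x \<bullet> v)) (at x)" and c: "continuous_on UNIV D"
    and Z: "\<And>x. x \<in> Z \<longleftrightarrow> f x = 0" and x0: "x0 \<in> Z" "D x0 \<noteq> 0"
  obtains \<rho> where "local_equation Z x0 \<rho> f"
proof -
  have "open {x. D x \<noteq> 0}"
    using c by (intro open_Collect_neq continuous_intros)
  then obtain \<rho> where \<rho>: "0 < \<rho>" "ball x0 \<rho> \<subseteq> {x. D x \<noteq> 0}"
    using x0(2) by (auto simp: open_contains_ball)
  have "grad f = D"
    using grad_eqI[OF D] by auto
  moreover have "cont_diff_on 1 (ball x0 \<rho>) f"
    using has_derivative_inner_differentiable[OF D] \<open>grad f = D\<close> continuous_on_subset[OF c]
    by (auto intro!: continuous_intros)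
  ultimately have "local_equation Z x0 \<rho> f"
    using \<rho> Z x0(1) by (auto simp: local_equation_def)
  then show thesis by (rule that)
qed

text \<open>The condition \<open>0 \<le> C\<close> also accounts for a non-integrable f, whose
  integral is 0 by convention.\<close>

lemma ball_integral_le:
  assumes "0 \<le> C" "0 \<le> r" "\<And>x. x \<in> ball x0 r \<Longrightarrow> f x \<le> C"
  shows "ball_integral x0 r f \<le> C * (pi * r\<^sup>2)"
proof -
  have "integrable lborel (\<lambda>x::real^2. indicator (ball x0 r) x * C)"
    by (rule integrable_ball_bounded[where C=C]) (use assms in auto)
  then have int: "integrable lebesgue (\<lambda>x::real^2. indicator (ball x0 r) x * C)"
    by (subst integrable_completion) (auto intro!: borel_measurable_times borel_measurable_indicator)
  have "ball_integral x0 r f \<le> (LINT x|lebesgue. indicator (ball x0 r) x * C)"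
    unfolding ball_integral_def set_lebesgue_integral_def
    by (rule integral_mono'[OF int]) (use assms in \<open>auto simp: indicator_def\<close>)
  also have "\<dots> = C * measure lebesgue (ball x0 r)"
    by simp
  also have "measure lebesgue (ball x0 r) = pi * r\<^sup>2"
    using assms(2) by (simp add: content_ball unit_ball_vol_2)
  finally show ?thesis .
qed

lemma circle_integral_le:
  assumes "0 \<le> C" "0 \<le> r" "\<And>\<theta>. f (x0 + r *\<^sub>R vector [cos \<theta>, sin \<theta>]) \<le> C"
  shows "circle_integral x0 r f \<le> C * (2 * pi * r)"
proof -
  have int: "integrable lebesgue (\<lambda>x::real. indicator {0..2*pi} x * (C * r))"
    by (intro integrable_mult_left integrable_real_indicator) auto
  have "circle_integral x0 r f \<le> (LINT x|lebesgue. indicator {0..2*pi} x * (C * r))"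
    unfolding circle_integral_def set_lebesgue_integral_def
    by (rule integral_mono'[OF int]) (use assms in \<open>auto simp: indicator_def intro!: mult_right_mono\<close>)
  also have "\<dots> = C * (2 * pi * r)"
    by simp
  finally show ?thesis .
qed

section \<open>The two-phase profiles\<close>

lemma wedge_grad_bound:
  assumes "0 < k" "0 \<le> d" "p\<^sup>2 + q\<^sup>2 = 1"
  shows "norm (wedge_grad k d p q x) \<le> 2 * k * (1 + d) * norm x"
proof -
  have "norm (sgn (quad p q x) *\<^sub>R qmat p q x) \<le> norm x"
    using assms by (auto simp: norm_qmat abs_sgn_eq)
  then have "norm (sgn (quad p q x) *\<^sub>R qmat p q x - d *\<^sub>R x) \<le> (1 + d) * norm x"
    using norm_triangle_ineq4[of "sgn (quad p q x) *\<^sub>R qmat p q x" "d *\<^sub>R x"] assms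
    by (simp add: distrib_right)
  from mult_left_mono[OF this, of "2 * k"] show ?thesis
    using assms by (simp add: wedge_grad_def mult.assoc abs_mult)
qed

lemma wedge_bound:
  assumes "0 < k" "0 \<le> d" "p\<^sup>2 + q\<^sup>2 = 1"
  shows "\<bar>wedge k d p q x\<bar> \<le> 2 * k * (1 + d) * (norm x)\<^sup>2"
  using wedge_lipschitz[OF assms, of x "norm x" 0]
  by (simp add: wedge_def quad_def power2_eq_square mult_ac)

lemma countable_sin_eq: "countable {\<theta>. sin \<theta> = (y::real)}"
proof (cases "\<exists>\<theta>0. sin \<theta>0 = y")
  case True
  then obtain \<theta>0 where \<theta>0: "sin \<theta>0 = y" by blast
  have "{\<theta>. sin \<theta> = y} \<subseteq> (\<lambda>n. \<theta>0 + 2 * n * pi) ` \<int> \<union> (\<lambda>n. - \<theta>0 + (2 * n + 1) * pi) ` \<int>"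
    unfolding \<theta>0[symmetric] by (auto simp: sin_eq)
  then show ?thesis
    by (rule countable_subset) (auto intro!: countable_Un countable_image countable_int)
qed auto

text \<open>On the line, cos \<theta> is an affine function of sin \<theta>; inserting it into cos^2
  + sin^2 = 1 makes sin \<theta> a root of a quadratic with leading coefficient 1 + k^2. Each root
  is attained at countably many angles.\<close>

lemma countable_circle_line:
  assumes r: "0 < r"
  shows "countable {\<theta>. (x0 + r *\<^sub>R vector [cos \<theta>, sin \<theta>] :: real^2) $ 1
    = k * (x0 + r *\<^sub>R vector [cos \<theta>, sin \<theta>] :: real^2) $ 2}"
proof -
  define m where "m = (k * x0 $ 2 - x0 $ 1) / r"
  let ?p = "[:m\<^sup>2 - 1, 2 * m * k, 1 + k\<^sup>2:]"
  have "1 + k\<^sup>2 \<noteq> 0"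
    by (metis add_pos_nonneg less_numeral_extra(1,3) zero_le_power2)
  then have fin: "finite {y. poly ?p y = 0}"
    by (intro poly_roots_finite) simp
  have "{\<theta>. (x0 + r *\<^sub>R vector [cos \<theta>, sin \<theta>] :: real^2) $ 1
    = k * (x0 + r *\<^sub>R vector [cos \<theta>, sin \<theta>] :: real^2) $ 2} \<subseteq> (\<Union>y\<in>{y. poly ?p y = 0}. {\<theta>. sin \<theta> = y})"
  proof
    fix \<theta> assume "\<theta> \<in> {\<theta>. (x0 + r *\<^sub>R vector [cos \<theta>, sin \<theta>] :: real^2) $ 1
      = k * (x0 + r *\<^sub>R vector [cos \<theta>, sin \<theta>] :: real^2) $ 2}"
    then have "cos \<theta> = m + k * sin \<theta>"
      using r by (simp add: m_def field_simps)
    moreover have "(cos \<theta>)\<^sup>2 = 1 - (sin \<theta>)\<^sup>2"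
      by (simp add: cos_squared_eq)
    ultimately have "poly ?p (sin \<theta>) = 0"
      by simp algebra
    then show "\<theta> \<in> (\<Union>y\<in>{y. poly ?p y = 0}. {\<theta>. sin \<theta> = y})"
      by blast
  qed
  then show ?thesis
    by (rule countable_subset) (intro countable_UN countable_finite fin countable_sin_eq)
qed

text \<open>In polar coordinates with \<open>p + q \<i> = e\<^bsup>2 \<i> \<alpha>\<^esup>\<close> the two nonzero components are
  \<open>(L c / 4) r\<^sup>2 (\<bar>cos (2 \<theta> - 2 \<alpha>)\<bar> - c)\<^sup>+\<close> and \<open>(L s / 4) r\<^sup>2 (\<bar>sin (2 \<theta> - 2 \<alpha>)\<bar> - s)\<^sup>+\<close>.\<close>

definition profile ::
    "'k \<Rightarrow> 'k \<Rightarrow> real \<Rightarrow> real \<Rightarrow> real \<Rightarrow> real \<Rightarrow> real \<Rightarrow> real^2 \<Rightarrow> real^'k" where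
  "profile i j L c s p q x = (\<chi> k.
     if k = i then wedge (L * c / 4) c p q x
     else if k = j then wedge (L * s / 4) s (- q) p x
     else 0)"

text \<open>The hypothesis \<open>c < p\<close> keeps the nodal lines away from the coordinate directions, so that every
  line parallel to an axis meets them in finitely many points.\<close>

locale two_phase =
  fixes lam :: "real^'k" and i j :: 'k and L c s p q :: real
  assumes ij: "i \<noteq> j" and lam: "lam $ i = L * c\<^sup>2" "lam $ j = L * s\<^sup>2"
    and pos: "0 < L" "0 < c" "0 < s" and cs: "c\<^sup>2 + s\<^sup>2 = 1" and pq: "p\<^sup>2 + q\<^sup>2 = 1" and cp: "c < p"
begin

section \<open>Signs, supports and the nodal function\<close>

abbreviation "A \<equiv> quad p q"
abbreviation "B \<equiv> quad (- q) p"
abbreviation "u \<equiv> profile i j L c s p q"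
abbreviation "u1 \<equiv> wedge (L * c / 4) c p q"
abbreviation "u2 \<equiv> wedge (L * s / 4) s (- q) p"

text \<open>A polynomial, hence smooth across the nodal lines, where \<open>u1\<close> and
  \<open>u2\<close> have kinks away from the origin. It can therefore serve as the local equation of
  the zero set.\<close>

definition "psi x = (A x)\<^sup>2 - c\<^sup>2 * (x \<bullet> x)\<^sup>2"

text \<open>\<open>W\<close> is the gradient of \<open>u1 - u2\<close>; its continuity across the nodal lines is the reflection law.\<close>

definition "W x = (if 0 \<le> psi x then wedge_grad (L * c / 4) c p q x
  else - wedge_grad (L * s / 4) s (- q) p x)"

text \<open>This is to be the total gradient of component k at every point (\<open>grad_u\<close>);
  on the nodal lines it is 0, in agreement with \<open>grad_eq_0_at_min\<close>.\<close>

definition "V k x = (if k = i \<and> 0 < psi x then W x else if k = j \<and> psi x < 0 then - W x else 0)"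

lemma pq': "(- q)\<^sup>2 + p\<^sup>2 = 1"
  using pq by simp

lemma k_pos: "0 < L * c / 4" "0 < L * s / 4" "0 \<le> c" "0 \<le> s"
  using pos by simp_all

lemma u_component: "u x $ k = (if k = i then u1 x else if k = j then u2 x else 0)"
  by (simp add: profile_def)

text \<open>A + i B is z^2 times a number of modulus 1, and |z^2| = |z|^2.\<close>

lemma A_B: "(A x)\<^sup>2 + (B x)\<^sup>2 = (x \<bullet> x)\<^sup>2"
proof -
  have "(A x)\<^sup>2 + (B x)\<^sup>2 = (p\<^sup>2 + q\<^sup>2) * (x \<bullet> x)\<^sup>2"
    unfolding quad_def inner_plane by algebra
  then show ?thesis using pq by simp
qed

text \<open>Expressing \<open>psi\<close> through \<open>B\<close> as well shows that the sectors of
  \<open>u1\<close> and \<open>u2\<close> are complementary, with common boundary the nodal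
  lines.\<close>

lemma psi_alt: "psi x = s\<^sup>2 * (x \<bullet> x)\<^sup>2 - (B x)\<^sup>2"
  using A_B[of x] cs unfolding psi_def by algebra

lemma psi_pos_iff: "0 < psi x \<longleftrightarrow> c * (x \<bullet> x) < \<bar>A x\<bar>" "0 < psi x \<longleftrightarrow> \<bar>B x\<bar> < s * (x \<bullet> x)"
proof -
  have "0 < psi x \<longleftrightarrow> (c * (x \<bullet> x))\<^sup>2 < (A x)\<^sup>2" "0 < psi x \<longleftrightarrow> (B x)\<^sup>2 < (s * (x \<bullet> x))\<^sup>2"
    by (simp add: psi_def power_mult_distrib) (simp add: psi_alt power_mult_distrib)
  moreover have "\<bar>c * (x \<bullet> x)\<bar> = c * (x \<bullet> x)" "\<bar>s * (x \<bullet> x)\<bar> = s * (x \<bullet> x)"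
    using pos by simp_all
  ultimately show "0 < psi x \<longleftrightarrow> c * (x \<bullet> x) < \<bar>A x\<bar>" "0 < psi x \<longleftrightarrow> \<bar>B x\<bar> < s * (x \<bullet> x)"
    by (metis abs_le_square_iff not_less)+
qed

lemma psi_neg_iff: "psi x < 0 \<longleftrightarrow> \<bar>A x\<bar> < c * (x \<bullet> x)" "psi x < 0 \<longleftrightarrow> s * (x \<bullet> x) < \<bar>B x\<bar>"
proof -
  have "psi x < 0 \<longleftrightarrow> (A x)\<^sup>2 < (c * (x \<bullet> x))\<^sup>2" "psi x < 0 \<longleftrightarrow> (s * (x \<bullet> x))\<^sup>2 < (B x)\<^sup>2"
    by (simp add: psi_def power_mult_distrib) (simp add: psi_alt power_mult_distrib)
  moreover have "\<bar>c * (x \<bullet> x)\<bar> = c * (x \<bullet> x)" "\<bar>s * (x \<bullet> x)\<bar> = s * (x \<bullet> x)"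
    using pos by simp_all
  ultimately show "psi x < 0 \<longleftrightarrow> \<bar>A x\<bar> < c * (x \<bullet> x)" "psi x < 0 \<longleftrightarrow> s * (x \<bullet> x) < \<bar>B x\<bar>"
    by (metis abs_le_square_iff not_less)+
qed

lemma psi_eq_0_D:
  assumes "psi x = 0"
  shows "\<bar>A x\<bar> = c * (x \<bullet> x)" "\<bar>B x\<bar> = s * (x \<bullet> x)"
  using psi_pos_iff[of x] psi_neg_iff[of x] assms by auto

lemma u1_pos_iff: "0 < u1 x \<longleftrightarrow> 0 < psi x"
  unfolding wedge_pos_iff[OF k_pos(1)] psi_pos_iff(1) ..

lemma u2_pos_iff: "0 < u2 x \<longleftrightarrow> psi x < 0"
  unfolding wedge_pos_iff[OF k_pos(2)] psi_neg_iff(2) ..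

lemma u1_eq_0_iff: "u1 x = 0 \<longleftrightarrow> psi x \<le> 0"
  using u1_pos_iff[of x] wedge_nonneg[of "L * c / 4" c p q x] k_pos by auto

lemma u2_eq_0_iff: "u2 x = 0 \<longleftrightarrow> 0 \<le> psi x"
  using u2_pos_iff[of x] wedge_nonneg[of "L * s / 4" s "- q" p x] k_pos by auto

lemma u_nonneg: "0 \<le> u x $ k"
  using k_pos by (simp add: u_component wedge_nonneg)

lemma u_pos_iff: "0 < u x $ k \<longleftrightarrow> (k = i \<and> 0 < psi x) \<or> (k = j \<and> psi x < 0)"
  using ij by (auto simp: u_component u1_pos_iff u2_pos_iff)

lemma u_segregated: "k \<noteq> l \<Longrightarrow> u x $ k * u x $ l = 0"
  by (cases "0 \<le> psi x") (auto simp: u_component u1_eq_0_iff u2_eq_0_iff)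

lemma u_eq_0_iff: "u x = 0 \<longleftrightarrow> psi x = 0"
proof
  assume "u x = 0"
  then have "u x $ i = 0" "u x $ j = 0" by simp_all
  then have "psi x \<le> 0" "0 \<le> psi x"
    using ij by (simp_all add: u_component u1_eq_0_iff u2_eq_0_iff)
  then show "psi x = 0" by simp
qed (simp add: vec_eq_iff u_component u1_eq_0_iff u2_eq_0_iff)

lemma zero_set_u: "zero_set u = {x. psi x = 0}"
  by (simp add: zero_set_def u_eq_0_iff)

lemma continuous_on_psi: "continuous_on S psi"
  unfolding psi_def by (intro continuous_intros)

lemma continuous_on_u: "continuous_on S (\<lambda>x. u x $ k)"
  unfolding u_component by (cases "k = i"; cases "k = j") (auto intro: continuous_intros)

section \<open>The nodal lines and their intersections with lines and circles\<close>

text \<open>\<open>psi\<close> is a product of four linear forms, because \<open>(p - c) (A - c N)\<close> and \<open>(p + c) (A + c N)\<close>,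
  with \<open>N = x \<bullet> x\<close>, are differences of squares.\<close>

definition slopes :: "real set" where
  "slopes = {(- q + s) / (p - c), (- q - s) / (p - c), (- q + s) / (p + c), (- q - s) / (p + c)}"

lemma finite_slopes: "finite slopes"
  by (simp add: slopes_def)

text \<open>A slope 0 would mean that the vertical axis is a nodal line. It would require q^2 = s^2,
  whereas c < p and the two normalizations force q^2 < s^2.\<close>

lemma zero_notin_slopes: "0 \<notin> slopes"
proof -
  have "c\<^sup>2 < p\<^sup>2"
    using cp pos by (intro power_strict_mono) auto
  then have "q\<^sup>2 < s\<^sup>2"
    using pq cs by linarith
  then have "q \<noteq> s" "q \<noteq> - s" by auto
  then show ?thesis
    using cp pos by (auto simp: slopes_def)
qed

lemma psi_eq_0_slope:
  assumes "psi x = 0"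
  shows "\<exists>k\<in>slopes. x $ 1 = k * x $ 2"
proof -
  have ne: "p - c > 0" "p + c > 0"
    using cp pos by auto
  have "psi x = (A x - c * (x \<bullet> x)) * (A x + c * (x \<bullet> x))"
    unfolding psi_def by algebra
  \<comment> \<open>Completing the square in x1 gives ((p - c) x1 + q x2)^2 - s^2 x2^2, since q^2 +
    p^2 - c^2 = 1 - c^2 = s^2.\<close>
  moreover have "(p - c) * (A x - c * (x \<bullet> x))
      = ((p - c) * x $ 1 - (- q + s) * x $ 2) * ((p - c) * x $ 1 - (- q - s) * x $ 2)"
    using pq cs unfolding quad_def inner_plane by algebra
  moreover have "(p + c) * (A x + c * (x \<bullet> x))
      = ((p + c) * x $ 1 - (- q + s) * x $ 2) * ((p + c) * x $ 1 - (- q - s) * x $ 2)"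
    using pq cs unfolding quad_def inner_plane by algebra
  ultimately have "(p - c) * x $ 1 = (- q + s) * x $ 2 \<or> (p - c) * x $ 1 = (- q - s) * x $ 2
      \<or> (p + c) * x $ 1 = (- q + s) * x $ 2 \<or> (p + c) * x $ 1 = (- q - s) * x $ 2"
    using assms by (metis mult_eq_0_iff right_minus_eq)
  then show ?thesis
    using ne by (auto simp: slopes_def field_simps)
qed

text \<open>Every nodal line has the form x1 = k x2, so a horizontal line meets it exactly once; as
  k is nonzero, so does a vertical line.\<close>

lemma finite_line: "finite {t. x + t *\<^sub>R axis l 1 \<in> {x. psi x = 0}}"
proof -
  consider "l = 1" | "l = 2"
    using exhaust_2 by blast
  then show ?thesis
  proof cases
    case 1
    have "{t. x + t *\<^sub>R axis l 1 \<in> {x. psi x = 0}} \<subseteq> (\<lambda>k. k * x $ 2 - x $ 1) ` slopes"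
    proof
      fix t assume "t \<in> {t. x + t *\<^sub>R axis l 1 \<in> {x. psi x = 0}}"
      then obtain k where "k \<in> slopes" "x $ 1 + t = k * x $ 2"
        using psi_eq_0_slope[of "x + t *\<^sub>R axis l 1"] by (auto simp: 1 axis_def)
      then show "t \<in> (\<lambda>k. k * x $ 2 - x $ 1) ` slopes"
        by (intro image_eqI[of _ _ k]) auto
    qed
    then show ?thesis
      using finite_slopes finite_surj by blast
  next
    case 2
    have "{t. x + t *\<^sub>R axis l 1 \<in> {x. psi x = 0}} \<subseteq> (\<lambda>k. x $ 1 / k - x $ 2) ` slopes"
    proof
      fix t assume "t \<in> {t. x + t *\<^sub>R axis l 1 \<in> {x. psi x = 0}}"
      then obtain k where "k \<in> slopes" "x $ 1 = k * (x $ 2 + t)"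
        using psi_eq_0_slope[of "x + t *\<^sub>R axis l 1"] by (auto simp: 2 axis_def)
      then show "t \<in> (\<lambda>k. x $ 1 / k - x $ 2) ` slopes"
        using zero_notin_slopes by (intro image_eqI[of _ _ k]) (auto simp: eq_divide_eq algebra_simps)
    qed
    then show ?thesis
      using finite_slopes finite_surj by blast
  qed
qed

lemma countable_circle:
  assumes r: "0 < r"
  shows "countable {\<theta>. x0 + r *\<^sub>R vector [cos \<theta>, sin \<theta>] \<in> {x. psi x = 0}}"
proof (rule countable_subset)
  show "{\<theta>. x0 + r *\<^sub>R vector [cos \<theta>, sin \<theta>] \<in> {x. psi x = 0}}
      \<subseteq> (\<Union>k\<in>slopes. {\<theta>. (x0 + r *\<^sub>R vector [cos \<theta>, sin \<theta>] :: real^2) $ 1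
        = k * (x0 + r *\<^sub>R vector [cos \<theta>, sin \<theta>] :: real^2) $ 2})"
    using psi_eq_0_slope by blast
qed (intro countable_UN countable_finite finite_slopes countable_circle_line r)

text \<open>A disc inside the zero set would contain a horizontal segment, that is, infinitely many
  zeros on one line.\<close>

lemma interior_zero_set: "interior (zero_set u) = {}"
proof (rule ccontr)
  assume "interior (zero_set u) \<noteq> {}"
  then obtain x e where e: "0 < e" "ball x e \<subseteq> {x. psi x = 0}"
    by (metis all_not_in_conv mem_interior zero_set_u)
  have "{0<..<e} \<subseteq> {t. x + t *\<^sub>R axis 1 1 \<in> {x. psi x = 0}}"
  proof
    fix t assume "t \<in> {0<..<e}"
    then have "x + t *\<^sub>R axis 1 1 \<in> ball x e"
      by (simp add: dist_norm norm_axis_1)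
    with e show "t \<in> {t. x + t *\<^sub>R axis 1 1 \<in> {x. psi x = 0}}" by blast
  qed
  then show False
    using finite_line[of x 1] e(1) infinite_Ioo[of 0 e] finite_subset by blast
qed

text \<open>Each branch is continuous on its closed union of sectors, so it suffices that the two
  branches agree where \<open>psi\<close> vanishes.\<close>

lemma continuous_W: "continuous_on UNIV W"
proof -
  have "continuous_on ({x. 0 \<le> psi x} \<union> {x. psi x \<le> 0}) W"
    unfolding W_def
  proof (rule continuous_on_cases)
    show "closed {x. 0 \<le> psi x}" "closed {x. psi x \<le> 0}"
      by (intro closed_Collect_le continuous_intros continuous_on_psi)+
    have "{x. 0 \<le> psi x} = {x. c * (x \<bullet> x) \<le> \<bar>A x\<bar>}" "{x. psi x \<le> 0} = {x. s * (x \<bullet> x) \<le> \<bar>B x\<bar>}"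
      using psi_neg_iff(1) psi_pos_iff(2) by (simp_all add: not_less[symmetric] del: not_less)
    then show "continuous_on {x. 0 \<le> psi x} (wedge_grad (L * c / 4) c p q)"
      "continuous_on {x. psi x \<le> 0} (\<lambda>x. - wedge_grad (L * s / 4) s (- q) p x)"
      unfolding wedge_grad_def using pos
      by (auto intro!: continuous_intros continuous_on_sgn_qmat)
    have "wedge_grad (L * c / 4) c p q x = - wedge_grad (L * s / 4) s (- q) p x" if "psi x = 0" for x
    proof -
      define a b where "a = sgn (A x)" and "b = sgn (B x)"
      have "A x = a * (c * (x \<bullet> x))" "B x = b * (s * (x \<bullet> x))"
        using psi_eq_0_D[OF that] sgn_mult_abs[of "A x"] sgn_mult_abs[of "B x"] by (simp_all add: a_def b_def)
      \<comment> \<open>With w = p + i q the right-hand side is (A + i B) w conj(z), and A + i B =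
        conj(w) z^2, so it equals |w|^2 |z|^2 z.\<close>
      moreover have "(x \<bullet> x) *\<^sub>R x = A x *\<^sub>R qmat p q x + B x *\<^sub>R qmat (- q) p x"
        using pq unfolding plane_eq_iff vector_add_component vector_scaleR_component qmat_simps
          quad_def inner_plane real_scaleR_def
        by (intro conjI; algebra)
      ultimately have "(x \<bullet> x) *\<^sub>R x = (x \<bullet> x) *\<^sub>R ((a * c) *\<^sub>R qmat p q x + (b * s) *\<^sub>R qmat (- q) p x)"
        by (simp add: scaleR_add_right mult_ac)
      \<comment> \<open>Dividing by |x|^2 writes x as the combination of the two matrix images with
        weights a c and b s. Splitting x as c^2 x + s^2 x then matches the two branches.\<close>
      then have "x = (a * c) *\<^sub>R qmat p q x + (b * s) *\<^sub>R qmat (- q) p x"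
        by (cases "x = 0") (simp_all add: scaleR_cancel_left del: qmat_simps, simp add: plane_eq_iff)
      then have x: "x $ 1 = a * c * (qmat p q x $ 1) + b * s * (qmat (- q) p x $ 1)"
        "x $ 2 = a * c * (qmat p q x $ 2) + b * s * (qmat (- q) p x $ 2)"
        by (metis vector_add_component vector_scaleR_component real_scaleR_def)+
      then show ?thesis
        using cs unfolding wedge_grad_def a_def[symmetric] b_def[symmetric] plane_eq_iff
          vector_minus_component vector_uminus_component vector_scaleR_component real_scaleR_def
        by (intro conjI; algebra)
    qed
    then show "\<forall>x. x \<in> {x. 0 \<le> psi x} \<and> \<not> 0 \<le> psi x \<or> x \<in> {x. psi x \<le> 0} \<and> 0 \<le> psi x \<longrightarrow>
        wedge_grad (L * c / 4) c p q x = - wedge_grad (L * s / 4) s (- q) p x"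
      by auto
  qed
  moreover have "{x. 0 \<le> psi x} \<union> {x. psi x \<le> 0} = UNIV" by auto
  ultimately show ?thesis by simp
qed

lemma coefficient_le: "2 * (L * c / 4) * (1 + c) \<le> L" "2 * (L * s / 4) * (1 + s) \<le> L"
proof -
  have "c\<^sup>2 \<le> 1\<^sup>2" "s\<^sup>2 \<le> 1\<^sup>2"
    unfolding one_power2 using cs zero_le_power2[of c] zero_le_power2[of s] by linarith+
  then have "c \<le> 1" "s \<le> 1"
    using power2_le_imp_le zero_le_one by blast+
  then have "2 * (L * c / 4) * (1 + c) \<le> 2 * (L * 1 / 4) * (1 + 1)"
    "2 * (L * s / 4) * (1 + s) \<le> 2 * (L * 1 / 4) * (1 + 1)"
    using pos by (intro mult_mono mult_nonneg_nonneg add_nonneg_nonneg; simp)+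
  then show "2 * (L * c / 4) * (1 + c) \<le> L" "2 * (L * s / 4) * (1 + s) \<le> L"
    by simp_all
qed

lemma W_bound: "norm (W x) \<le> L * norm x"
proof -
  have "norm (wedge_grad (L * c / 4) c p q x) \<le> L * norm x"
    by (rule order_trans[OF wedge_grad_bound[OF k_pos(1,3) pq]])
      (intro mult_right_mono coefficient_le norm_ge_zero)
  moreover have "norm (wedge_grad (L * s / 4) s (- q) p x) \<le> L * norm x"
    by (rule order_trans[OF wedge_grad_bound[OF k_pos(2,4) pq']])
      (intro mult_right_mono coefficient_le norm_ge_zero)
  ultimately show ?thesis by (simp add: W_def)
qed

lemma u_component_bound: "\<bar>u x $ k\<bar> \<le> L * (norm x)\<^sup>2"
proof -
  have "\<bar>u1 x\<bar> \<le> L * (norm x)\<^sup>2"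
    by (rule order_trans[OF wedge_bound[OF k_pos(1,3) pq]])
      (intro mult_right_mono coefficient_le zero_le_power2)
  moreover have "\<bar>u2 x\<bar> \<le> L * (norm x)\<^sup>2"
    by (rule order_trans[OF wedge_bound[OF k_pos(2,4) pq']])
      (intro mult_right_mono coefficient_le zero_le_power2)
  ultimately show ?thesis
    using pos by (simp add: u_component)
qed

lemma V_bound: "norm (V k x) \<le> L * norm x"
  using W_bound[of x] pos by (auto simp: V_def)

lemma grad_u: "grad (\<lambda>y. u y $ k) x = V k x"
proof -
  have "grad u1 x = V i x"
    by (simp add: grad_wedge[OF k_pos(1,3)] u1_pos_iff V_def W_def ij)
  moreover have "grad u2 x = V j x"
    using ij by (simp add: grad_wedge[OF k_pos(2,4)] u2_pos_iff V_def W_def)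
  moreover have "grad (\<lambda>y::real^2. 0::real) x = 0"
    by (rule grad_eqI) simp
  ultimately show ?thesis
    using ij by (cases "k = i"; cases "k = j") (simp_all add: u_component V_def)
qed

lemma has_derivative_u:
  assumes "psi x \<noteq> 0"
  shows "((\<lambda>y. u y $ k) has_derivative (\<lambda>v. V k x \<bullet> v)) (at x)"
proof -
  have "(u1 has_derivative (\<lambda>v. V i x \<bullet> v)) (at x)"
    using assms has_derivative_wedge[OF k_pos(3), of x p q] has_derivative_wedge_zero[of p q x c] ij
    by (cases "0 < psi x") (auto simp: V_def W_def psi_pos_iff(1)[symmetric] psi_neg_iff(1)[symmetric])
  moreover have "(u2 has_derivative (\<lambda>v. V j x \<bullet> v)) (at x)"
    using assms has_derivative_wedge[OF k_pos(4), of x "- q" p] has_derivative_wedge_zero[of "- q" p x s] ij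
    by (cases "0 < psi x") (auto simp: V_def W_def psi_pos_iff(2)[symmetric] psi_neg_iff(2)[symmetric])
  ultimately show ?thesis
    using ij by (cases "k = i"; cases "k = j") (simp_all add: u_component V_def)
qed

section \<open>Membership in the Sobolev space and in the class of solutions\<close>

lemma measurable_psi [measurable]: "psi \<in> borel_measurable borel"
  and measurable_quad [measurable]: "quad a b \<in> borel_measurable borel"
  by (intro borel_measurable_continuous_onI continuous_on_psi continuous_on_quad)+

lemma measurable_V: "(\<lambda>x. V k x $ l) \<in> borel_measurable borel"
proof -
  have [measurable]: "(\<lambda>x. W x $ l) \<in> borel_measurable borel"
    by (intro borel_measurable_continuous_onI continuous_on_component continuous_W)
  have "(\<lambda>x. V k x $ l) = (\<lambda>x. if k = i \<and> 0 < psi x then W x $ l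
      else if k = j \<and> psi x < 0 then - (W x $ l) else 0)"
    by (auto simp: V_def)
  also have "\<dots> \<in> borel_measurable borel"
    by measurable
  finally show ?thesis .
qed

lemma V_component_bound: "\<exists>C. \<forall>x\<in>ball 0 r. \<bar>V k x $ l\<bar> \<le> C"
proof (intro exI ballI)
  fix x :: "real^2" assume "x \<in> ball 0 r"
  then have "L * norm x \<le> L * r"
    using pos by simp
  then show "\<bar>V k x $ l\<bar> \<le> L * r"
    using component_le_norm_cart[of "V k x" l] V_bound[of k x] by linarith
qed

lemma u_H1_loc: "(\<lambda>x. u x $ k) \<in> H1_loc"
proof -
  have "(\<lambda>x. u x $ k) \<in> L2_loc"
    by (intro L2_loc_I exists_bound_continuous continuous_on_u borel_measurable_continuous_onI)
  moreover have "\<exists>g\<in>L2_loc. weak_partial (\<lambda>x. u x $ k) b g" if b: "b \<in> Basis" for b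
  proof -
    obtain l where l: "b = axis l 1"
      using b by (auto simp: Basis_vec_def)
    show ?thesis
      unfolding l
    proof (rule bexI)
      show "weak_partial (\<lambda>x. u x $ k) (axis l 1) (\<lambda>x. V k x $ l)"
        by (rule weak_partial_piecewise[OF continuous_on_u has_derivative_u finite_line measurable_V V_component_bound])
          auto
      show "(\<lambda>x. V k x $ l) \<in> L2_loc"
        by (intro L2_loc_I measurable_V V_component_bound)
    qed
  qed
  ultimately show ?thesis
    by (simp add: H1_loc_def)
qed

lemma u_H1_loc_Sigma: "u \<in> H1_loc_Sigma"
proof -
  have "u x \<in> Sigma_set" for x
  proof -
    have "(u x $ a)\<^sup>2 * (u x $ b)\<^sup>2 = 0" if "a \<noteq> b" for a b
      using u_segregated[OF that, of x] by auto
    then show ?thesis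
      by (auto simp: Sigma_set_def intro!: sum.neutral)
  qed
  then show ?thesis
    by (simp add: H1_loc_Sigma_def u_H1_loc)
qed

lemma u_two_homogeneous: "two_homogeneous u"
  by (simp add: two_homogeneous_def vec_eq_iff u_component wedge_scale)

lemma u_lipschitz: "\<exists>K. K-lipschitz_on (ball x \<rho> \<inter> T) u"
proof -
  define R where "R = norm x + \<bar>\<rho>\<bar>"
  define M where "M = L * c / 4 * (1 + c) * (2 * R) + L * s / 4 * (1 + s) * (2 * R)"
  have R0: "0 \<le> R" by (simp add: R_def)
  have t: "0 \<le> L * c / 4 * (1 + c) * (2 * R)" "0 \<le> L * s / 4 * (1 + s) * (2 * R)"
    using R0 pos by simp_all
  have R: "norm y \<le> R" if "y \<in> ball x \<rho>" for y
    using that norm_triangle_sub[of y x] by (auto simp: R_def dist_norm norm_minus_commute)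
  have comp: "\<bar>u y $ k - u z $ k\<bar> \<le> M * norm (y - z)" if "norm y \<le> R" "norm z \<le> R" for y z k
  proof -
    have "\<bar>u1 y - u1 z\<bar> \<le> M * norm (y - z)"
      using wedge_lipschitz[OF k_pos(1,3) pq that] mult_right_mono[OF t(2) norm_ge_zero[of "y - z"]]
      unfolding M_def distrib_right by linarith
    moreover have "\<bar>u2 y - u2 z\<bar> \<le> M * norm (y - z)"
      using wedge_lipschitz[OF k_pos(2,4) pq' that] mult_right_mono[OF t(1) norm_ge_zero[of "y - z"]]
      unfolding M_def distrib_right by linarith
    moreover have "0 \<le> M * norm (y - z)"
      using t by (simp add: M_def)
    ultimately show ?thesis
      by (simp add: u_component)
  qed
  have "(CARD('k) * M)-lipschitz_on (ball x \<rho> \<inter> T) u"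
  proof (rule lipschitz_onI)
    fix y z assume "y \<in> ball x \<rho> \<inter> T" "z \<in> ball x \<rho> \<inter> T"
    then have yz: "norm y \<le> R" "norm z \<le> R" using R by auto
    have "norm (u y - u z) \<le> (\<Sum>k\<in>UNIV. \<bar>(u y - u z) $ k\<bar>)"
      by (rule norm_le_l1_cart)
    also have "\<dots> \<le> (\<Sum>k\<in>(UNIV :: 'k set). M * norm (y - z))"
      by (intro sum_mono) (use comp[OF yz] in simp)
    finally show "dist (u y) (u z) \<le> CARD('k) * M * dist y z"
      by (simp add: dist_norm mult.assoc)
  next
    show "0 \<le> CARD('k) * M"
      using t by (simp add: M_def)
  qed
  then show ?thesis by blast
qed

lemma u_cont_diff: "cont_diff_on 2 {x\<in>T. 0 < u x $ k} (\<lambda>x. u x $ k)"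
proof -
  have "cont_diff_on 2 {x\<in>T. 0 < u1 x} u1" "cont_diff_on 2 {x\<in>T. 0 < u2 x} u2"
    by (auto intro!: cont_diff_wedge k_pos)
  \<comment> \<open>The remaining components vanish identically, so their positivity sets are
    empty.\<close>
  moreover have "cont_diff_on 2 {} (\<lambda>x::real^2. 0)"
    by (simp add: numeral_2_eq_2)
  ultimately show ?thesis
    using ij by (cases "k = i"; cases "k = j") (simp_all add: u_component)
qed

text \<open>The prefactors L c / 4 and L s / 4 are chosen for this: 4 (L c / 4) c = L c^2 is the
  i-th entry of \<open>lam\<close>, and likewise for j.\<close>

lemma u_laplacian:
  assumes "0 < u x $ k"
  shows "- laplacian (\<lambda>y. u y $ k) x = lam $ k"
  using assms ij laplacian_wedge[OF k_pos(1,3), of p q x] laplacian_wedge[OF k_pos(2,4), of "- q" p x]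
  by (cases "k = i"; cases "k = j") (simp_all add: u_component lam power2_eq_square)

lemma sum_two:
  fixes f :: "'k \<Rightarrow> real"
  assumes "\<And>k. k \<noteq> i \<Longrightarrow> k \<noteq> j \<Longrightarrow> f k = 0"
  shows "sum f UNIV = f i + f j"
proof -
  have "sum f UNIV = sum f {i, j}"
    by (rule sum.mono_neutral_right) (use assms in auto)
  then show ?thesis using ij by simp
qed

text \<open>The flux identity is applied to W, the gradient of u1 - u2, and to the potential G. Off
  the nodal lines exactly one component is positive and its gradient is W up to sign, so the
  quadratic integrands agree. The term with factor N - 2 vanishes in the plane.\<close>

lemma u_pohozaev:
  assumes r: "0 < r"
  shows "pohozaev_identity lam u x0 r"
proof -
  define G where "G x = lam \<bullet> u x" for x
  \<comment> \<open>g is minus the Laplacian of u1 - u2. The minus sign in the second branch also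
    makes g W the gradient of G, because the gradient of u2 is - W there.\<close>
  define g where "g x = (if 0 \<le> psi x then lam $ i else - lam $ j)" for x
  \<comment> \<open>The entries of the piecewise constant Hessian of u1 - u2. On the nodal lines
    they take the values of the first formula, so that the trace identity holds at every
    point.\<close>
  define w11 where "w11 x = (if 0 \<le> psi x then (L * c / 2) * (sgn (A x) * p - c)
    else - (L * s / 2) * (sgn (B x) * (- q) - s))" for x
  define w12 where "w12 x = (if 0 \<le> psi x then (L * c / 2) * (sgn (A x) * q)
    else - (L * s / 2) * (sgn (B x) * p))" for x
  define w22 where "w22 x = (if 0 \<le> psi x then (L * c / 2) * (sgn (A x) * (- p) - c)
    else - (L * s / 2) * (sgn (B x) * q - s))" for x
  have G_eq: "G x = lam $ i * u x $ i + lam $ j * u x $ j" for x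
    unfolding G_def inner_vec_def using sum_two[of "\<lambda>k. lam $ k \<bullet> u x $ k"] by (simp add: u_component)
  have cG: "continuous_on UNIV G"
    unfolding G_eq by (intro continuous_intros continuous_on_u)
  have dW: "((\<lambda>y. W y \<bullet> b) has_derivative (\<lambda>v. (if 0 \<le> psi x
      then (2 * (L * c / 4)) *\<^sub>R (sgn (A x) *\<^sub>R qmat p q b - c *\<^sub>R b)
      else - ((2 * (L * s / 4)) *\<^sub>R (sgn (B x) *\<^sub>R qmat (- q) p b - s *\<^sub>R b))) \<bullet> v)) (at x)"
    if "psi x \<noteq> 0" for x b
  proof (cases "0 < psi x")
    case True
    have op: "open {x. 0 < psi x}"
      by (intro open_Collect_less continuous_intros continuous_on_psi)
    have "((\<lambda>y. W y \<bullet> b) has_derivative (\<lambda>v.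
        ((2 * (L * c / 4)) *\<^sub>R (sgn (A x) *\<^sub>R qmat p q b - c *\<^sub>R b)) \<bullet> v)) (at x)"
      by (rule has_derivative_transform_within_open[OF has_derivative_wedge_grad[OF k_pos(3)] op])
        (use True in \<open>auto simp: W_def psi_pos_iff(1)[symmetric]\<close>)
    then show ?thesis
      using True by simp
  next
    case False
    then have neg: "psi x < 0" using that by simp
    have op: "open {x. psi x < 0}"
      by (intro open_Collect_less continuous_intros continuous_on_psi)
    have "((\<lambda>y. W y \<bullet> b) has_derivative (\<lambda>v.
        - (((2 * (L * s / 4)) *\<^sub>R (sgn (B x) *\<^sub>R qmat (- q) p b - s *\<^sub>R b)) \<bullet> v))) (at x)"
      by (rule has_derivative_transform_within_open
          [OF has_derivative_minus[OF has_derivative_wedge_grad[OF k_pos(4)]] op])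
        (use neg in \<open>auto simp: W_def psi_neg_iff(2)[symmetric]\<close>)
    then show ?thesis
      using neg by simp
  qed
  have m: "(\<lambda>x. sgn (quad a b x)) \<in> borel_measurable borel" for a b
    by measurable
  note [measurable] = m
  have sg: "\<exists>C. \<forall>x\<in>ball x0 r. \<bar>sgn (quad a b x)\<bar> \<le> C" for a b
    by (intro exI[of _ 1]) (simp add: abs_sgn_eq)
  have bif: "\<exists>C. \<forall>x\<in>ball x0 r. \<bar>if 0 \<le> psi x then f x else h x\<bar> \<le> C"
    if fh: "\<exists>C. \<forall>x\<in>ball x0 r. \<bar>f x\<bar> \<le> C" "\<exists>C. \<forall>x\<in>ball x0 r. \<bar>h x\<bar> \<le> C" for f h :: "real^2 \<Rightarrow> real"
  proof -
    obtain C D where "\<forall>x\<in>ball x0 r. \<bar>f x\<bar> \<le> C" "\<forall>x\<in>ball x0 r. \<bar>h x\<bar> \<le> D"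
      using fh by blast
    then show ?thesis
      by (intro exI[of _ "max C D"]) (auto simp: le_max_iff_disj)
  qed
  note bounds = bif exists_bound_intros sg
  have "r * circle_integral x0 r (\<lambda>x. W x \<bullet> W x) =
    2 * r * circle_integral x0 r (\<lambda>x. (W x \<bullet> ((x - x0) /\<^sub>R r))\<^sup>2)
    + 2 * r * circle_integral x0 r G - 4 * ball_integral x0 r G"
  proof (rule pohozaev_flux_identity[where S="{x. psi x = 0}" and g=g and ?w11.0=w11 and ?w12.0=w12 and ?w22.0=w22])
    fix x :: "real^2"
    assume "x \<notin> {x. psi x = 0}"
    then have x: "psi x \<noteq> 0" by simp
    have e: "W y $ l = W y \<bullet> axis l 1" for y l
      by (simp add: inner_axis)
    have ax: "axis (1::2) 1 $ 1 = (1::real)" "axis (1::2) 1 $ 2 = (0::real)"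
      "axis (2::2) 1 $ 1 = (0::real)" "axis (2::2) 1 $ 2 = (1::real)"
      by (simp_all add: axis_def)
    show "((\<lambda>y. W y $ 1) has_derivative (\<lambda>v. w11 x * v $ 1 + w12 x * v $ 2)) (at x)"
      unfolding e by (rule has_derivative_eq_rhs[OF dW[OF x]])
        (simp add: fun_eq_iff inner_plane ax w11_def w12_def algebra_simps)
    show "((\<lambda>y. W y $ 2) has_derivative (\<lambda>v. w12 x * v $ 1 + w22 x * v $ 2)) (at x)"
      unfolding e by (rule has_derivative_eq_rhs[OF dW[OF x]])
        (simp add: fun_eq_iff inner_plane ax w12_def w22_def algebra_simps)
    show "(G has_derivative (\<lambda>v. g x * (W x \<bullet> v))) (at x)"
      unfolding G_eq[abs_def] using x ij
      by (auto intro!: derivative_eq_intros has_derivative_u simp: fun_eq_iff g_def V_def)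
  next
    show "w11 x + w22 x = - g x" for x
      by (simp add: w11_def w22_def g_def lam power2_eq_square algebra_simps)
    show "w11 \<in> borel_measurable borel" "w12 \<in> borel_measurable borel"
      "w22 \<in> borel_measurable borel" "g \<in> borel_measurable borel"
      unfolding w11_def[abs_def] w12_def[abs_def] w22_def[abs_def] g_def[abs_def] by measurable
    show "\<exists>C. \<forall>x\<in>ball x0 r. \<bar>w11 x\<bar> \<le> C" "\<exists>C. \<forall>x\<in>ball x0 r. \<bar>w12 x\<bar> \<le> C"
      "\<exists>C. \<forall>x\<in>ball x0 r. \<bar>w22 x\<bar> \<le> C" "\<exists>C. \<forall>x\<in>ball x0 r. \<bar>g x\<bar> \<le> C"
      unfolding w11_def[abs_def] w12_def[abs_def] w22_def[abs_def] g_def[abs_def] by (intro bounds)+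
  qed (use continuous_W cG finite_line r in auto)
  moreover have "circle_integral x0 r (grad_sq u) = circle_integral x0 r (\<lambda>x. W x \<bullet> W x)"
  proof (rule circle_integral_cong_countable[OF countable_circle[OF r]])
    fix x assume "x \<notin> {x. psi x = 0}"
    moreover have "grad_sq u x = (norm (V i x))\<^sup>2 + (norm (V j x))\<^sup>2"
      unfolding grad_sq_def grad_u by (rule sum_two) (simp add: V_def)
    ultimately show "grad_sq u x = W x \<bullet> W x"
      using ij by (auto simp: V_def dot_square_norm)
  qed
  moreover have "circle_integral x0 r (\<lambda>x. deriv_dir_sq u ((x - x0) /\<^sub>R r) x)
      = circle_integral x0 r (\<lambda>x. (W x \<bullet> ((x - x0) /\<^sub>R r))\<^sup>2)"
  proof (rule circle_integral_cong_countable[OF countable_circle[OF r]])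
    fix x assume "x \<notin> {x. psi x = 0}"
    moreover have "deriv_dir_sq u ((x - x0) /\<^sub>R r) x
        = (V i x \<bullet> ((x - x0) /\<^sub>R r))\<^sup>2 + (V j x \<bullet> ((x - x0) /\<^sub>R r))\<^sup>2"
      unfolding deriv_dir_sq_def grad_u by (rule sum_two) (simp add: V_def)
    ultimately show "deriv_dir_sq u ((x - x0) /\<^sub>R r) x = (W x \<bullet> ((x - x0) /\<^sub>R r))\<^sup>2"
      using ij by (auto simp: V_def)
  qed
  ultimately show ?thesis
    by (simp add: pohozaev_identity_def G_def[abs_def])
qed

text \<open>The value at this one point is positive because c < p, and it determines p. It serves
  for non-triviality and for telling the solutions apart.\<close>

lemma u_axis: "u (axis 1 1) $ i = L * c / 4 * (p - c)"
  using cp pos by (simp add: u_component wedge_def quad_def inner_plane axis_def)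

lemma u_T_loc: "u \<in> T_loc lam"
proof -
  have "u (axis 1 1) \<noteq> 0"
    using u_axis cp pos by (metis diff_gt_0_iff_gt k_pos(1) less_irrefl mult_pos_pos zero_index)
  then show ?thesis
    unfolding T_loc_def T_class_def
    using u_nonneg u_lipschitz u_segregated u_cont_diff u_laplacian u_pohozaev
    by (auto intro: zero_less_one)
qed

section \<open>Regular points and the reflection law\<close>

lemma psi_has_derivative:
  "(psi has_derivative (\<lambda>v. ((4 * A x) *\<^sub>R qmat p q x - (4 * c\<^sup>2 * (x \<bullet> x)) *\<^sub>R x) \<bullet> v)) (at x)"
  unfolding psi_def[abs_def]
  by (rule derivative_eq_intros has_derivative_quad refl)+
    (simp add: fun_eq_iff inner_plane power2_eq_square algebra_simps)

text \<open>The gradient does not vanish since the tangential derivative of \<open>psi\<close> is \<open>- 4 A B\<close>, and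
  both \<open>A\<close> and \<open>B\<close> are non-zero on the nodal lines away from the origin.\<close>

lemma psi_local_equation:
  assumes "psi x0 = 0" "x0 \<noteq> 0"
  obtains \<rho> where "local_equation (zero_set u) x0 \<rho> psi"
proof (rule local_equationI[OF psi_has_derivative])
  show "continuous_on UNIV (\<lambda>x. (4 * A x) *\<^sub>R qmat p q x - (4 * c\<^sup>2 * (x \<bullet> x)) *\<^sub>R x)"
    by (intro continuous_intros)
  show "x \<in> zero_set u \<longleftrightarrow> psi x = 0" for x
    by (simp add: zero_set_u)
  show "x0 \<in> zero_set u"
    using assms by (simp add: zero_set_u)
  have "((4 * A x0) *\<^sub>R qmat p q x0 - (4 * c\<^sup>2 * (x0 \<bullet> x0)) *\<^sub>R x0) \<bullet> vector [- x0 $ 2, x0 $ 1]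
      = - 4 * A x0 * B x0"
    unfolding quad_def inner_plane vector_2 vector_minus_component vector_scaleR_component
      qmat_simps real_scaleR_def by algebra
  moreover have "\<bar>A x0\<bar> > 0" "\<bar>B x0\<bar> > 0"
    using psi_eq_0_D[OF assms(1)] assms(2) pos by simp_all
  ultimately show "(4 * A x0) *\<^sub>R qmat p q x0 - (4 * c\<^sup>2 * (x0 \<bullet> x0)) *\<^sub>R x0 \<noteq> 0"
    by auto
qed (rule that)

text \<open>Near the origin u is O(r^2) and its gradient O(r), so the scaled norm is O(r^2) and the
  vanishing order is at least 2. This excludes the crossing point of the nodal lines.\<close>

lemma origin_not_regular: "0 \<notin> regular_set u"
proof
  assume "0 \<in> regular_set u"
  then have 1: "vanishing_order u 0 = 1"
    by (simp add: regular_set_def)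
  \<comment> \<open>For each component the disc term contributes pi L^2 r^4, and the circle term,
    after division by r, 2 pi L^2 r^4.\<close>
  define C where "C = CARD('k) * (3 * pi * L\<^sup>2)"
  have bound: "scaled_norm u 0 r / r powr 2 \<le> sqrt C" if r: "0 < r" for r
  proof -
    have summand: "1 / r ^ (spacedim - 2) * ball_integral 0 r (\<lambda>x. (norm (grad (\<lambda>y. u y $ k) x))\<^sup>2)
      + 1 / r ^ (spacedim - 1) * circle_integral 0 r (\<lambda>x. (u x $ k)\<^sup>2) \<le> 3 * pi * L\<^sup>2 * r ^ 4" for k
    proof -
      have "ball_integral 0 r (\<lambda>x. (norm (grad (\<lambda>y. u y $ k) x))\<^sup>2) \<le> (L * r)\<^sup>2 * (pi * r\<^sup>2)"
      proof (rule ball_integral_le)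
        fix x :: "real^2" assume "x \<in> ball 0 r"
        then have "L * norm x \<le> L * r"
          using pos by simp
        then show "(norm (grad (\<lambda>y. u y $ k) x))\<^sup>2 \<le> (L * r)\<^sup>2"
          using V_bound[of k x] by (intro power_mono) (auto simp: grad_u)
      qed (use r in auto)
      moreover have "circle_integral 0 r (\<lambda>x. (u x $ k)\<^sup>2) \<le> (L * r\<^sup>2)\<^sup>2 * (2 * pi * r)"
      proof (rule circle_integral_le)
        fix \<theta> :: real
        have "norm (vector [cos \<theta>, sin \<theta>] :: real^2) = 1"
          by (simp add: norm_eq_sqrt_inner inner_plane flip: power2_eq_square)
        then have "\<bar>u (0 + r *\<^sub>R vector [cos \<theta>, sin \<theta>]) $ k\<bar> \<le> L * r\<^sup>2"
          using u_component_bound[of "0 + r *\<^sub>R vector [cos \<theta>, sin \<theta>]" k] r by simp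
        then show "(u (0 + r *\<^sub>R vector [cos \<theta>, sin \<theta>]) $ k)\<^sup>2 \<le> (L * r\<^sup>2)\<^sup>2"
          by (metis abs_ge_zero power2_abs power_mono)
      qed (use r in auto)
      then have "1 / r * circle_integral 0 r (\<lambda>x. (u x $ k)\<^sup>2) \<le> 2 * pi * L\<^sup>2 * r ^ 4"
        using r by (simp add: field_simps power2_eq_square eval_nat_numeral)
      ultimately show ?thesis
        by (simp add: power_mult_distrib power2_eq_square eval_nat_numeral algebra_simps)
    qed
    have "scaled_norm u 0 r \<le> sqrt (\<Sum>k\<in>(UNIV :: 'k set). 3 * pi * L\<^sup>2 * r ^ 4)"
      unfolding scaled_norm_def by (intro real_sqrt_le_mono sum_mono summand)
    also have "\<dots> = sqrt (C * (r\<^sup>2)\<^sup>2)"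
      by (simp add: C_def power_mult[symmetric] mult_ac)
    also have "\<dots> = sqrt C * r\<^sup>2"
      by (simp only: real_sqrt_mult real_sqrt_abs abs_power2)
    finally show ?thesis
      using r by (simp add: divide_le_eq)
  qed
  have "Limsup (at_right 0) (\<lambda>r. ereal (scaled_norm u 0 r / r powr 2)) \<le> ereal (sqrt C)"
    by (intro Limsup_bounded) (use bound in \<open>auto simp: eventually_at_right_less eventually_at_filter\<close>)
  then have "Limsup (at_right 0) (\<lambda>r. ereal (scaled_norm u 0 r / r powr 2)) < \<infinity>"
    by auto
  then have "ereal 2 \<le> vanishing_order u 0"
    unfolding vanishing_order_def by (intro SUP_upper) auto
  then show False
    using 1 by (simp add: one_ereal_def)
qed

text \<open>The gradient is W where component i is positive and - W where component j is, and W is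
  continuous at x0. The opposite signs of these limits are the reflection law. For any other index
  the filter is trivial.\<close>

lemma grad_u_tendsto:
  "((\<lambda>x. grad (\<lambda>y. u y $ k) x \<bullet> \<nu>) \<longlongrightarrow> (if k = i then 1 else -1) * (W x0 \<bullet> \<nu>))
    (at x0 within {x. 0 < u x $ k})"
proof (rule Lim_transform_eventually)
  have "isCont W x0"
    using continuous_W by (simp add: continuous_on_eq_continuous_at)
  then have "(W \<longlongrightarrow> W x0) (at x0 within {x. 0 < u x $ k})"
    using continuous_at_imp_continuous_at_within continuous_within by blast
  then have "((\<lambda>x. W x \<bullet> \<nu>) \<longlongrightarrow> W x0 \<bullet> \<nu>) (at x0 within {x. 0 < u x $ k})"
    by (intro tendsto_intros)
  then show "((\<lambda>x. (if k = i then 1 else -1) * (W x \<bullet> \<nu>)) \<longlongrightarrow> (if k = i then 1 else -1) * (W x0 \<bullet> \<nu>))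
    (at x0 within {x. 0 < u x $ k})"
    by (rule tendsto_mult_left)
  show "\<forall>\<^sub>F x in at x0 within {x. 0 < u x $ k}.
      (if k = i then 1 else -1) * (W x \<bullet> \<nu>) = grad (\<lambda>y. u y $ k) x \<bullet> \<nu>"
    using ij by (auto simp: eventually_at_filter u_pos_iff grad_u V_def)
qed

lemma grad_u_tendsto_vacuous:
  assumes "k \<noteq> i" "k \<noteq> j"
  shows "((\<lambda>x. grad (\<lambda>y. u y $ k) x \<bullet> \<nu>) \<longlongrightarrow> l) (at x0 within {x. 0 < u x $ k})"
  using assms by (simp add: u_pos_iff)

lemma u_reflection_law: "reflection_law u"
  unfolding reflection_law_def
proof (intro ballI conjI allI impI)
  fix x0 assume reg: "x0 \<in> regular_set u"
  then have x0: "psi x0 = 0" "x0 \<noteq> 0"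
    using origin_not_regular by (auto simp: regular_set_def zero_set_u)
  obtain \<rho> where \<rho>: "local_equation (zero_set u) x0 \<rho> psi"
    using psi_local_equation[OF x0] .
  then have "grad psi x0 \<noteq> 0"
    by (simp add: local_equation_def)
  then have "norm (inverse (norm (grad psi x0)) *\<^sub>R grad psi x0) = 1"
    by simp
  with \<rho> show "\<exists>\<nu>. unit_normal (zero_set u) x0 \<nu>"
    unfolding unit_normal_def by blast
  show "\<exists>a b. positive_sides u x0 a b"
    unfolding positive_sides_def using \<rho> ij u_pos_iff by metis
  fix \<nu> a b assume "unit_normal (zero_set u) x0 \<nu> \<and> positive_sides u x0 a b"
  then have "a \<noteq> b"
    by (simp add: positive_sides_def)
  \<comment> \<open>An index other than i and j has an empty positivity set, so every number is a
    limit for it; l is then dictated by the other index.\<close>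
  then consider "a = i" "b = j" | "a = i" "b \<noteq> i" "b \<noteq> j" | "a = j" "b \<noteq> j" | "a \<noteq> i" "a \<noteq> j"
    by blast
  then show "\<exists>l. ((\<lambda>x. grad (\<lambda>y. u y $ a) x \<bullet> \<nu>) \<longlongrightarrow> l) (at x0 within {x. 0 < u x $ a}) \<and>
             ((\<lambda>x. grad (\<lambda>y. u y $ b) x \<bullet> \<nu>) \<longlongrightarrow> - l) (at x0 within {x. 0 < u x $ b})"
  proof cases
    case 1
    then show ?thesis
      using ij grad_u_tendsto[of i \<nu> x0] grad_u_tendsto[of j \<nu> x0] by (intro exI[of _ "W x0 \<bullet> \<nu>"]) auto
  next
    case 2
    then show ?thesis
      using grad_u_tendsto[of i \<nu> x0] grad_u_tendsto_vacuous[of b] by blast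
  next
    case 3
    then show ?thesis
      using ij grad_u_tendsto[of j \<nu> x0] grad_u_tendsto[of i \<nu> x0] grad_u_tendsto_vacuous[of b]
      by (intro exI[of _ "- (W x0 \<bullet> \<nu>)"]) (cases "b = i"; auto)
  next
    case 4
    then show ?thesis
      using grad_u_tendsto[of b \<nu> x0] grad_u_tendsto_vacuous[of a]
      by (intro exI[of _ "- ((if b = i then 1 else -1) * (W x0 \<bullet> \<nu>))"]) (simp only: minus_minus; blast)
  qed
qed

end

section \<open>Infinitely many solutions from the rotation parameter\<close>

theorem proposition9p1:
  fixes lam :: "real^'k"
  assumes "CARD('k) \<ge> 2"
    and "\<And>i. 0 < lam $ i"
  shows "infinite {u :: real^2 \<Rightarrow> real^'k.
           two_homogeneous u \<and> u \<in> H1_loc_Sigma \<and>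
           u \<in> T_loc lam \<and>
           interior (zero_set u) = {} \<and>
           reflection_law u}"
    (is "infinite ?X")
proof -
  obtain i j :: 'k where ij: "i \<noteq> j"
    using assms(1) card_le_Suc0_iff_eq[of "UNIV :: 'k set"] by fastforce
  define L where "L = lam $ i + lam $ j"
  define c where "c = sqrt (lam $ i / L)"
  define s where "s = sqrt (lam $ j / L)"
  have pos: "0 < lam $ i" "0 < lam $ j" "0 < L"
    using assms(2)[of i] assms(2)[of j] by (simp_all add: L_def)
  have c2: "c\<^sup>2 = lam $ i / L" "s\<^sup>2 = lam $ j / L" and cs0: "0 < c" "0 < s"
    using pos by (simp_all add: c_def s_def)
  have cs: "c\<^sup>2 + s\<^sup>2 = 1"
    using pos by (simp add: c2 L_def flip: add_divide_distrib)
  then have "c\<^sup>2 < 1\<^sup>2"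
    using cs0(2) by (simp add: c2) (metis add.commute less_add_same_cancel2 pos(2,3) divide_pos_pos)
  then have c1: "c < 1"
    by (rule power2_less_imp_less) simp
  \<comment> \<open>The parameter p ranges over the interval from c to 1, which is nonempty because
    s > 0; q is the nonnegative root that completes p to a unit vector.\<close>
  have sol: "two_phase lam i j L c s p (sqrt (1 - p\<^sup>2))" if "p \<in> {c<..<1}" for p
  proof
    have "p\<^sup>2 \<le> 1\<^sup>2"
      using that cs0 by (intro power_mono) auto
    then show "p\<^sup>2 + (sqrt (1 - p\<^sup>2))\<^sup>2 = 1"
      by simp
  qed (use ij pos cs cs0 c2 that in auto)
  have "inj_on (\<lambda>p. profile i j L c s p (sqrt (1 - p\<^sup>2))) {c<..<1}"
  proof (rule inj_onI)
    fix p p' assume p: "p \<in> {c<..<1}" "p' \<in> {c<..<1}"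
      and eq: "profile i j L c s p (sqrt (1 - p\<^sup>2)) = profile i j L c s p' (sqrt (1 - p'\<^sup>2))"
    have "L * c / 4 * (p - c) = L * c / 4 * (p' - c)"
      using two_phase.u_axis[OF sol[OF p(1)]] two_phase.u_axis[OF sol[OF p(2)]] eq by metis
    then show "p = p'"
      using pos cs0 by simp
  qed
  moreover have "(\<lambda>p. profile i j L c s p (sqrt (1 - p\<^sup>2))) ` {c<..<1} \<subseteq> ?X"
    using two_phase.u_two_homogeneous[OF sol] two_phase.u_H1_loc_Sigma[OF sol]
      two_phase.u_T_loc[OF sol] two_phase.interior_zero_set[OF sol]
      two_phase.u_reflection_law[OF sol]
    by (intro image_subsetI CollectI conjI)
  ultimately show ?thesis
    using infinite_Ioo[OF c1] inj_on_finite by blast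
qed

end
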